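(* Let $T$ be any complete theory and $M\models T$. Every type over $M$ has a global extension which is a Kim-strict $M$-invariant type.
   Context: Work in a monster model $\mathbb{M}$. A global type is a complete type over $\mathbb{M}$; it is $M$-invariant if for every formula $\varphi(x;y)$ and $c\equiv_M c'$, $\varphi(x;c)\in q$ iff $\varphi(x;c')\in q$. A Morley sequence over $M$ for $q$ is $(b_i)_{i<\omega}$ with $b_i\models q|_{Mb_{<i}}$. $\varphi(x;b)$ Kim-divides over $M$ if it divides (i.e. $\{\varphi(x;b_i)\}$ is inconsistent) along some Morley sequence over $M$ for some global $M$-invariant type extending $\mathrm{tp}(b/M)$. $\varphi(x;b)$ Kim-forks over $M$ if it implies a finite disjunction of formulas (possibly with different parameters) each of which Kim-divides over $M$. $A\mathop{\smile\!\!\!\!\!\mid}^K_M B$ means $\mathrm{tp}(A/MB)$ contains no formula Kim-forking over $M$. A global $M$-invariant type $p$ is Kim-strict (over $M$) if for every set $B$, whenever $a\models p|_{MB}$, we have $B\mathop{\smile\!\!\!\!\!\mid}^K_M a$. *)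

theory Defs
  imports Main
begin

unbundle cardinal_syntax

record ('f, 'r) lang =
  funs :: "('f \<times> nat) set"
  rels :: "('r \<times> nat) set"

text \<open>Variables are de Bruijn indices: \<open>All \<phi>\<close> binds index \<open>0\<close> of \<open>\<phi>\<close>.\<close>

datatype 'f tm = Var nat | Fn 'f "'f tm list"

datatype ('f, 'r) fm =
    Fls
  | Eq "'f tm" "'f tm"
  | Rl 'r "'f tm list"
  | Imp "('f, 'r) fm" "('f, 'r) fm"
  | All "('f, 'r) fm"

abbreviation Neg :: "('f, 'r) fm \<Rightarrow> ('f, 'r) fm" where
  "Neg \<phi> \<equiv> Imp \<phi> Fls"

primrec tm_vars :: "'f tm \<Rightarrow> nat set" where
  "tm_vars (Var i) = {i}"
| "tm_vars (Fn f ts) = \<Union> (set (map tm_vars ts))"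

primrec fv :: "('f, 'r) fm \<Rightarrow> nat set" where
  "fv Fls = {}"
| "fv (Eq s t) = tm_vars s \<union> tm_vars t"
| "fv (Rl r ts) = \<Union> (tm_vars ` set ts)"
| "fv (Imp \<phi> \<psi>) = fv \<phi> \<union> fv \<psi>"
| "fv (All \<phi>) = {i. Suc i \<in> fv \<phi>}"

primrec wf_tm :: "('f, 'r) lang \<Rightarrow> 'f tm \<Rightarrow> bool" where
  "wf_tm L (Var i) \<longleftrightarrow> True"
| "wf_tm L (Fn f ts) \<longleftrightarrow> (f, length ts) \<in> funs L \<and> list_all (wf_tm L) ts"

primrec wf_fm :: "('f, 'r) lang \<Rightarrow> ('f, 'r) fm \<Rightarrow> bool" where
  "wf_fm L Fls \<longleftrightarrow> True"
| "wf_fm L (Eq s t) \<longleftrightarrow> wf_tm L s \<and> wf_tm L t"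
| "wf_fm L (Rl r ts) \<longleftrightarrow> (r, length ts) \<in> rels L \<and> list_all (wf_tm L) ts"
| "wf_fm L (Imp \<phi> \<psi>) \<longleftrightarrow> wf_fm L \<phi> \<and> wf_fm L \<psi>"
| "wf_fm L (All \<phi>) \<longleftrightarrow> wf_fm L \<phi>"

definition formulas :: "('f, 'r) lang \<Rightarrow> ('f, 'r) fm set" where
  "formulas L = {\<phi>. wf_fm L \<phi>}"

definition sentences :: "('f, 'r) lang \<Rightarrow> ('f, 'r) fm set" where
  "sentences L = {\<phi> \<in> formulas L. fv \<phi> = {}}"

record ('a, 'f, 'r) struct =
  carrier :: "'a set"
  fun_of :: "'f \<Rightarrow> 'a list \<Rightarrow> 'a"
  rel_of :: "'r \<Rightarrow> 'a list \<Rightarrow> bool"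

definition structure_for :: "('f, 'r) lang \<Rightarrow> ('a, 'f, 'r) struct \<Rightarrow> bool" where
  "structure_for L A \<longleftrightarrow> carrier A \<noteq> {} \<and>
     (\<forall>(f, n) \<in> funs L. \<forall>xs \<in> lists (carrier A). length xs = n \<longrightarrow> fun_of A f xs \<in> carrier A)"

primrec tm_val :: "('a, 'f, 'r) struct \<Rightarrow> (nat \<Rightarrow> 'a) \<Rightarrow> 'f tm \<Rightarrow> 'a" where
  "tm_val A e (Var i) = e i"
| "tm_val A e (Fn f ts) = fun_of A f (map (tm_val A e) ts)"

primrec sat :: "('a, 'f, 'r) struct \<Rightarrow> (nat \<Rightarrow> 'a) \<Rightarrow> ('f, 'r) fm \<Rightarrow> bool" where
  "sat A e Fls \<longleftrightarrow> False"
| "sat A e (Eq s t) \<longleftrightarrow> tm_val A e s = tm_val A e t"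
| "sat A e (Rl r ts) \<longleftrightarrow> rel_of A r (map (tm_val A e) ts)"
| "sat A e (Imp \<phi> \<psi>) \<longleftrightarrow> (sat A e \<phi> \<longrightarrow> sat A e \<psi>)"
| "sat A e (All \<phi>) \<longleftrightarrow> (\<forall>z \<in> carrier A. sat A (case_nat z e) \<phi>)"

definition is_model :: "('f, 'r) lang \<Rightarrow> ('f, 'r) fm set \<Rightarrow> ('a, 'f, 'r) struct \<Rightarrow> bool" where
  "is_model L T A \<longleftrightarrow> structure_for L A \<and>
     (\<forall>\<phi> \<in> T. \<forall>e. range e \<subseteq> carrier A \<longrightarrow> sat A e \<phi>)"

text \<open>Semantic consequence. It suffices to range over structures whose carrier is a set of
  elements of type \<^typ>\<open>('f, 'r) fm\<close>: this type is infinite and at least as large as the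
  language, so by downward Loewenheim-Skolem every structure for the language is elementarily
  equivalent to such a structure.\<close>

definition entails :: "('f, 'r) lang \<Rightarrow> ('f, 'r) fm set \<Rightarrow> ('f, 'r) fm \<Rightarrow> bool" where
  "entails L T \<phi> \<longleftrightarrow>
     (\<forall>A :: (('f, 'r) fm, 'f, 'r) struct. is_model L T A \<longrightarrow> is_model L {\<phi>} A)"

definition complete_theory :: "('f, 'r) lang \<Rightarrow> ('f, 'r) fm set \<Rightarrow> bool" where
  "complete_theory L T \<longleftrightarrow> T \<subseteq> sentences L \<and> \<not> entails L T Fls \<and>
     (\<forall>\<phi> \<in> sentences L. entails L T \<phi> \<or> entails L T (Neg \<phi>))"

definition elementary_submodel ::
  "('f, 'r) lang \<Rightarrow> ('a, 'f, 'r) struct \<Rightarrow> ('a, 'f, 'r) struct \<Rightarrow> bool" where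
  "elementary_submodel L A B \<longleftrightarrow>
     structure_for L A \<and> structure_for L B \<and> carrier A \<subseteq> carrier B \<and>
     (\<forall>(f, n) \<in> funs L. \<forall>xs \<in> lists (carrier A). length xs = n \<longrightarrow> fun_of A f xs = fun_of B f xs) \<and>
     (\<forall>(r, n) \<in> rels L. \<forall>xs \<in> lists (carrier A). length xs = n \<longrightarrow> rel_of A r xs = rel_of B r xs) \<and>
     (\<forall>\<phi> \<in> formulas L. \<forall>e. range e \<subseteq> carrier A \<longrightarrow> (sat A e \<phi> \<longleftrightarrow> sat B e \<phi>))"

definition automorphism ::
  "('f, 'r) lang \<Rightarrow> ('a, 'f, 'r) struct \<Rightarrow> ('a \<Rightarrow> 'a) \<Rightarrow> bool" where
  "automorphism L A \<sigma> \<longleftrightarrow> bij_betw \<sigma> (carrier A) (carrier A) \<and>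
     (\<forall>(f, n) \<in> funs L. \<forall>xs \<in> lists (carrier A). length xs = n \<longrightarrow>
        \<sigma> (fun_of A f xs) = fun_of A f (map \<sigma> xs)) \<and>
     (\<forall>(r, n) \<in> rels L. \<forall>xs \<in> lists (carrier A). length xs = n \<longrightarrow>
        (rel_of A r xs \<longleftrightarrow> rel_of A r (map \<sigma> xs)))"

text \<open>The triple \<open>(\<phi>, xs, c)\<close> stands for the formula \<open>\<phi>(x; c)\<close>, where \<open>\<phi>(x; y)\<close> is a formula of
  the language, \<open>x\<close> is the finite tuple of variables named by the list \<open>xs\<close> and \<open>c\<close> is a finite
  tuple of parameters: the de Bruijn indices below \<open>length xs\<close> are the variables \<open>x\<close>, the next
  \<open>length c\<close> ones are \<open>y\<close>. Types may be in an arbitrary tuple of variables, indexed by a set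
  \<open>I :: 'v set\<close>; tuples realizing them are functions on \<open>'v\<close>, of which only the values on \<open>I\<close>
  matter.\<close>

type_synonym ('a, 'f, 'r, 'v) pfm = "('f, 'r) fm \<times> 'v list \<times> 'a list"

definition pformulas ::
  "('f, 'r) lang \<Rightarrow> 'v set \<Rightarrow> 'a set \<Rightarrow> ('a, 'f, 'r, 'v) pfm set" where
  "pformulas L I A = {(\<phi>, xs, c). \<phi> \<in> formulas L \<and> xs \<in> lists I \<and> c \<in> lists A \<and>
     fv \<phi> \<subseteq> {..<length xs + length c}}"

fun psat :: "('a, 'f, 'r) struct \<Rightarrow> ('v \<Rightarrow> 'a) \<Rightarrow> ('a, 'f, 'r, 'v) pfm \<Rightarrow> bool" where
  "psat U a (\<phi>, xs, c) \<longleftrightarrow> sat U ((!) (map a xs @ c)) \<phi>"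

definition realizes ::
  "('a, 'f, 'r) struct \<Rightarrow> ('v \<Rightarrow> 'a) \<Rightarrow> ('a, 'f, 'r, 'v) pfm set \<Rightarrow> bool" where
  "realizes U a p \<longleftrightarrow> range a \<subseteq> carrier U \<and> (\<forall>\<chi> \<in> p. psat U a \<chi>)"

definition consistent :: "('a, 'f, 'r) struct \<Rightarrow> ('a, 'f, 'r, 'v) pfm set \<Rightarrow> bool" where
  "consistent U p \<longleftrightarrow> (\<forall>F. finite F \<and> F \<subseteq> p \<longrightarrow> (\<exists>a. realizes U a F))"

definition type_over ::
  "('f, 'r) lang \<Rightarrow> ('a, 'f, 'r) struct \<Rightarrow> 'v set \<Rightarrow> 'a set \<Rightarrow> ('a, 'f, 'r, 'v) pfm set \<Rightarrow> bool" where
  "type_over L U I A p \<longleftrightarrow> p \<subseteq> pformulas L I A \<and> consistent U p"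

definition complete_type_over ::
  "('f, 'r) lang \<Rightarrow> ('a, 'f, 'r) struct \<Rightarrow> 'v set \<Rightarrow> 'a set \<Rightarrow> ('a, 'f, 'r, 'v) pfm set \<Rightarrow> bool" where
  "complete_type_over L U I A p \<longleftrightarrow> type_over L U I A p \<and>
     (\<forall>(\<phi>, xs, c) \<in> pformulas L I A. (\<phi>, xs, c) \<in> p \<or> (Neg \<phi>, xs, c) \<in> p)"

definition global_type ::
  "('f, 'r) lang \<Rightarrow> ('a, 'f, 'r) struct \<Rightarrow> 'v set \<Rightarrow> ('a, 'f, 'r, 'v) pfm set \<Rightarrow> bool" where
  "global_type L U I q \<longleftrightarrow> complete_type_over L U I (carrier U) q"

definition restrict_type ::
  "('a, 'f, 'r, 'v) pfm set \<Rightarrow> 'a set \<Rightarrow> ('a, 'f, 'r, 'v) pfm set" where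
  "restrict_type q A = {(\<phi>, xs, c) \<in> q. c \<in> lists A}"

definition tp ::
  "('f, 'r) lang \<Rightarrow> ('a, 'f, 'r) struct \<Rightarrow> 'v set \<Rightarrow> ('v \<Rightarrow> 'a) \<Rightarrow> 'a set \<Rightarrow>
   ('a, 'f, 'r, 'v) pfm set" where
  "tp L U I a A = {\<chi> \<in> pformulas L I A. psat U a \<chi>}"

definition tp_list ::
  "('f, 'r) lang \<Rightarrow> ('a, 'f, 'r) struct \<Rightarrow> 'a list \<Rightarrow> 'a set \<Rightarrow> ('a, 'f, 'r, nat) pfm set" where
  "tp_list L U b A = tp L U {..<length b} ((!) b) A"

text \<open>The type of a set is the type of the set enumerated by itself.\<close>

definition tp_set ::
  "('f, 'r) lang \<Rightarrow> ('a, 'f, 'r) struct \<Rightarrow> 'a set \<Rightarrow> 'a set \<Rightarrow> ('a, 'f, 'r, 'a) pfm set" where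
  "tp_set L U B A = tp L U B (\<lambda>x. x) A"

definition equiv_over ::
  "('f, 'r) lang \<Rightarrow> ('a, 'f, 'r) struct \<Rightarrow> 'a set \<Rightarrow> 'a list \<Rightarrow> 'a list \<Rightarrow> bool" where
  "equiv_over L U A c c' \<longleftrightarrow> length c = length c' \<and> tp_list L U c A = tp_list L U c' A"

text \<open>Cardinals are represented by cardinal orders \<open>\<kappa>\<close>; a set \<open>A\<close> is small if \<open>|A| <o \<kappa>\<close>.\<close>

definition saturated ::
  "('f, 'r) lang \<Rightarrow> 'k rel \<Rightarrow> ('a, 'f, 'r) struct \<Rightarrow> bool" where
  "saturated L \<kappa> U \<longleftrightarrow>
     (\<forall>A n p. A \<subseteq> carrier U \<and> |A| <o \<kappa> \<and> type_over L U {..<n::nat} A p \<longrightarrow> (\<exists>a. realizes U a p))"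

definition strongly_homogeneous ::
  "('f, 'r) lang \<Rightarrow> 'k rel \<Rightarrow> ('a, 'f, 'r) struct \<Rightarrow> bool" where
  "strongly_homogeneous L \<kappa> U \<longleftrightarrow>
     (\<forall>A g. A \<subseteq> carrier U \<and> |A| <o \<kappa> \<and> g ` A \<subseteq> carrier U \<and>
        (\<forall>c \<in> lists A. equiv_over L U {} c (map g c)) \<longrightarrow>
        (\<exists>\<sigma>. automorphism L U \<sigma> \<and> (\<forall>x \<in> A. \<sigma> x = g x)))"

text \<open>The set of formulas has cardinality \<open>|L| + \<aleph>\<^sub>0\<close>, so \<open>\<kappa>\<close> is uncountable and
  larger than the language.\<close>

definition monster_model ::
  "('f, 'r) lang \<Rightarrow> ('f, 'r) fm set \<Rightarrow> 'k rel \<Rightarrow> ('a, 'f, 'r) struct \<Rightarrow> bool" where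
  "monster_model L T \<kappa> U \<longleftrightarrow> is_model L T U \<and> Card_order \<kappa> \<and> |formulas L| <o \<kappa> \<and>
     saturated L \<kappa> U \<and> strongly_homogeneous L \<kappa> U"

definition invariant_type ::
  "('f, 'r) lang \<Rightarrow> ('a, 'f, 'r) struct \<Rightarrow> 'v set \<Rightarrow> 'a set \<Rightarrow> ('a, 'f, 'r, 'v) pfm set \<Rightarrow> bool" where
  "invariant_type L U I M q \<longleftrightarrow> global_type L U I q \<and>
     (\<forall>(\<phi>, xs, c) \<in> pformulas L I (carrier U). \<forall>c' \<in> lists (carrier U).
        equiv_over L U M c c' \<longrightarrow> ((\<phi>, xs, c) \<in> q \<longleftrightarrow> (\<phi>, xs, c') \<in> q))"

definition Morley_sequence ::
  "('a, 'f, 'r) struct \<Rightarrow> 'v set \<Rightarrow> 'a set \<Rightarrow> ('a, 'f, 'r, 'v) pfm set \<Rightarrow>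
   (nat \<Rightarrow> 'v \<Rightarrow> 'a) \<Rightarrow> bool" where
  "Morley_sequence U I M q s \<longleftrightarrow>
     (\<forall>i. realizes U (s i) (restrict_type q (M \<union> (\<Union>j<i. s j ` I))))"

definition Kim_divides ::
  "('f, 'r) lang \<Rightarrow> ('a, 'f, 'r) struct \<Rightarrow> 'a set \<Rightarrow> ('a, 'f, 'r, 'v) pfm \<Rightarrow> bool" where
  "Kim_divides L U M \<chi> \<longleftrightarrow> (case \<chi> of (\<phi>, xs, b) \<Rightarrow>
     \<exists>q s. invariant_type L U {..<length b} M q \<and> tp_list L U b M \<subseteq> q \<and>
       Morley_sequence U {..<length b} M q s \<and>
       \<not> consistent U (range (\<lambda>i. (\<phi>, xs, map (s i) [0..<length b]))))"

definition Kim_forks ::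
  "('f, 'r) lang \<Rightarrow> ('a, 'f, 'r) struct \<Rightarrow> 'a set \<Rightarrow> ('a, 'f, 'r, 'v) pfm \<Rightarrow> bool" where
  "Kim_forks L U M \<chi> \<longleftrightarrow> (case \<chi> of (\<phi>, xs, b) \<Rightarrow>
     \<exists>D. finite D \<and> D \<subseteq> pformulas L (set xs) (carrier U) \<and>
       (\<forall>\<theta> \<in> D. Kim_divides L U M \<theta>) \<and>
       (\<forall>a. range a \<subseteq> carrier U \<and> psat U a (\<phi>, xs, b) \<longrightarrow> (\<exists>\<theta> \<in> D. psat U a \<theta>)))"

definition Kim_independent ::
  "('f, 'r) lang \<Rightarrow> ('a, 'f, 'r) struct \<Rightarrow> 'a set \<Rightarrow> 'a set \<Rightarrow> 'a set \<Rightarrow> bool" where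
  "Kim_independent L U M A B \<longleftrightarrow> (\<forall>\<chi> \<in> tp_set L U A (M \<union> B). \<not> Kim_forks L U M \<chi>)"

definition Kim_strict ::
  "('f, 'r) lang \<Rightarrow> 'k rel \<Rightarrow> ('a, 'f, 'r) struct \<Rightarrow> 'v set \<Rightarrow> 'a set \<Rightarrow>
   ('a, 'f, 'r, 'v) pfm set \<Rightarrow> bool" where
  "Kim_strict L \<kappa> U I M q \<longleftrightarrow> invariant_type L U I M q \<and>
     (\<forall>B a. B \<subseteq> carrier U \<and> |B| <o \<kappa> \<and> realizes U a (restrict_type q (M \<union> B)) \<longrightarrow>
        Kim_independent L U M B (a ` I))"

end

theory Submission
  imports Defs
begin

text \<open>A set of assignments quasi-divides over \<open>M\<close> if finitely many of its conjugates under
  \<open>Aut(U/M)\<close> have empty intersection. Every Kim-forking formula quasi-divides. Indeed, if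
  \<open>\<phi>(x; b)\<close> divides along a Morley sequence of an invariant type, then given finitely many
  conjugates of \<open>b\<close> there is a further conjugate \<open>b'\<close> realizing the type over all of them, so that
  each \<open>\<phi>(x; b') \<and> \<phi>(x; b'')\<close> divides along a shorter sequence. This gives a rank, called
  \<open>evasive\<close> below, and an induction on the multiset of ranks shows that a set covered by finitely
  many ranked sets quasi-divides.

  Now fix a completion of \<open>p\<close> over \<open>M\<close> and a finite tuple \<open>a\<close> realizing a finite part of it. If
  \<open>\<psi>(a; y)\<close> quasi-divides, then by elementarity there are \<open>m\<^sub>1, \<dots>, m\<^sub>k\<close> in \<open>M\<close>, satisfying any
  given formula of the completion, with \<open>\<psi>(m\<^sub>1; y) \<and> \<dots> \<and> \<psi>(m\<^sub>k; y)\<close> inconsistent; hence for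
  every \<open>d\<close> some \<open>m\<^sub>i\<close> satisfies \<open>\<not> \<psi>(x; d)\<close>. So some coheir of the completion contains all the
  formulas \<open>\<not> \<psi>(x; d)\<close> with \<open>\<psi>(a; y)\<close> Kim-forking, and it is Kim-strict.\<close>

subsection \<open>Renaming variables\<close>

text \<open>In an arbitrary theory Kim-forking cannot be replaced by Kim-dividing: a Kim-forking
  formula is only known to be covered by formulas that divide along Morley sequences of unrelated
  types. No single sequence witnesses its inconsistency, so one settles for a finite family of
  conjugates in no particular arrangement. This suffices, because only a finite pattern is ever
  transferred to \<open>M\<close>. Quasi-division is not visibly preserved by unions; hence the
  induction runs over covers by ranked sets, and over arbitrary sets of assignments, since
  translating and intersecting leaves the instances of any one formula. Two ultrafilters on
  assignments occur. Which formulas \<psi>(x; y) have to be omitted depends on the type over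
  \<open>M\<close> of a realization, so the first ultrafilter fixes a completion of
  \<open>p\<close>, and only then the second one, with the same completion, omits the instances.
  Note the exchange of roles: smallness concerns \<psi>(a; y) as a set of tuples y, whereas the
  omitted instances are \<psi>(x; d).\<close>

primrec rename_tm :: "(nat \<Rightarrow> nat) \<Rightarrow> 'f tm \<Rightarrow> 'f tm" where
  "rename_tm f (Var i) = Var (f i)"
| "rename_tm f (Fn g ts) = Fn g (map (rename_tm f) ts)"

primrec rename_fm :: "(nat \<Rightarrow> nat) \<Rightarrow> ('f, 'r) fm \<Rightarrow> ('f, 'r) fm" where
  "rename_fm f Fls = Fls"
| "rename_fm f (Eq s t) = Eq (rename_tm f s) (rename_tm f t)"
| "rename_fm f (Rl r ts) = Rl r (map (rename_tm f) ts)"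
| "rename_fm f (Imp \<phi> \<psi>) = Imp (rename_fm f \<phi>) (rename_fm f \<psi>)"
| "rename_fm f (All \<phi>) = All (rename_fm (case_nat 0 (Suc \<circ> f)) \<phi>)"

lemma tm_val_rename: "tm_val A e (rename_tm f t) = tm_val A (e \<circ> f) t"
  by (induction t) (auto cong: map_cong simp: comp_def)

lemma sat_rename: "sat A e (rename_fm f \<phi>) \<longleftrightarrow> sat A (e \<circ> f) \<phi>"
proof (induction \<phi> arbitrary: e f)
  case (All \<phi>)
  have "case_nat z e \<circ> case_nat 0 (Suc \<circ> f) = case_nat z (e \<circ> f)" for z
    by (auto simp: fun_eq_iff split: nat.split)
  then show ?case by (simp only: rename_fm.simps sat.simps All)
qed (auto simp: tm_val_rename comp_def)

lemma tm_vars_rename: "tm_vars (rename_tm f t) = f ` tm_vars t"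
  by (induction t) auto

lemma fv_rename: "fv (rename_fm f \<phi>) = f ` fv \<phi>"
proof (induction \<phi> arbitrary: f)
  case (All \<phi>)
  have "Suc i = case_nat 0 (Suc \<circ> f) j \<longleftrightarrow> (\<exists>k. j = Suc k \<and> i = f k)" for i j
    by (cases j) auto
  then show ?case by (auto simp: All image_iff)
qed (auto simp: tm_vars_rename)

lemma wf_tm_rename: "wf_tm L (rename_tm f t) \<longleftrightarrow> wf_tm L t"
  by (induction t) (auto simp: list_all_iff)

lemma wf_fm_rename: "wf_fm L (rename_fm f \<phi>) \<longleftrightarrow> wf_fm L \<phi>"
  by (induction \<phi> arbitrary: f) (auto simp: list_all_iff wf_tm_rename)

lemma tm_val_cong: "(\<And>i. i \<in> tm_vars t \<Longrightarrow> e i = e' i) \<Longrightarrow> tm_val A e t = tm_val A e' t"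
proof (induction t)
  case (Fn g ts)
  then have "map (tm_val A e) ts = map (tm_val A e') ts" by auto
  then show ?case by (metis tm_val.simps(2))
qed simp

lemma sat_cong: "(\<And>i. i \<in> fv \<phi> \<Longrightarrow> e i = e' i) \<Longrightarrow> sat A e \<phi> \<longleftrightarrow> sat A e' \<phi>"
proof (induction \<phi> arbitrary: e e')
  case (Rl r ts)
  then have "map (tm_val A e) ts = map (tm_val A e') ts" by (auto intro!: tm_val_cong)
  then show ?case by (metis sat.simps(3))
next
  case (All \<phi>)
  have "sat A (case_nat z e) \<phi> \<longleftrightarrow> sat A (case_nat z e') \<phi>" for z
    by (rule All.IH) (auto split: nat.split intro!: All.prems)
  then show ?case by simp
next
  case (Eq s t)
  then show ?case by (auto cong: tm_val_cong)
next
  case (Imp \<phi> \<psi>)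
  have "sat A e \<phi> \<longleftrightarrow> sat A e' \<phi>" "sat A e \<psi> \<longleftrightarrow> sat A e' \<psi>"
    by (rule Imp; simp add: Imp.prems)+
  then show ?case by simp
qed simp

text \<open>The lists attach labels to de Bruijn positions and \<open>h\<close> interprets labels.
  Sending each position to one with the same label turns a formula over \<open>u\<close> into one
  over \<open>u'\<close>; this brings formulas with different variable lists to a common
  list.\<close>

lemma reindex_formula:
  assumes "\<phi> \<in> formulas L" and fv: "fv \<phi> \<subseteq> {..<length u}" and sub: "set u \<subseteq> set u'"
  obtains \<psi> where "\<psi> \<in> formulas L" "fv \<psi> \<subseteq> {..<length u'}"
    "\<And>h. sat A ((!) (map h u')) \<psi> \<longleftrightarrow> sat A ((!) (map h u)) \<phi>"
proof -
  have "\<forall>k. \<exists>j. k < length u \<longrightarrow> j < length u' \<and> u ! k = u' ! j"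
    using sub by (metis in_set_conv_nth subsetD)
  then obtain f where f: "\<And>k. k < length u \<Longrightarrow> f k < length u' \<and> u ! k = u' ! f k"
    by metis
  show thesis
  proof
    show "rename_fm f \<phi> \<in> formulas L"
      using assms(1) by (simp add: formulas_def wf_fm_rename)
    show "fv (rename_fm f \<phi>) \<subseteq> {..<length u'}"
      using fv f by (auto simp: fv_rename)
    show "sat A ((!) (map h u')) (rename_fm f \<phi>) \<longleftrightarrow> sat A ((!) (map h u)) \<phi>"
      for h
      unfolding sat_rename
      by (rule sat_cong) (use fv f in \<open>auto simp: subset_iff\<close>)
  qed
qed

section \<open>Blocks of existential quantifiers\<close>

abbreviation Ex :: "('f, 'r) fm \<Rightarrow> ('f, 'r) fm" where
  "Ex \<phi> \<equiv> Neg (All (Neg \<phi>))"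

lemma sat_Ex_funpow:
  "sat A e ((Ex ^^ n) \<phi>) \<longleftrightarrow>
     (\<exists>zs \<in> lists (carrier A). length zs = n \<and>
        sat A (\<lambda>k. if k < n then zs ! k else e (k - n)) \<phi>)"
proof (induction n arbitrary: \<phi>)
  case 0
  show ?case by simp
next
  case (Suc n)
  have env: "case_nat z (\<lambda>k. if k < n then zs ! k else e (k - n)) =
      (\<lambda>k. if k < Suc n then (z # zs) ! k else e (k - Suc n))" for z zs
    by (auto simp: fun_eq_iff split: nat.split)
  \<comment> \<open>Peel off the innermost quantifier: it binds index 0, so its witness becomes the
    head of the list.\<close>
  have "sat A e ((Ex ^^ Suc n) \<phi>) \<longleftrightarrow> sat A e ((Ex ^^ n) (Ex \<phi>))"
    by (simp only: funpow_Suc_right comp_apply)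
  also have "\<dots> \<longleftrightarrow> (\<exists>zs \<in> lists (carrier A). length zs = n \<and> (\<exists>z \<in> carrier A.
      sat A (\<lambda>k. if k < Suc n then (z # zs) ! k else e (k - Suc n)) \<phi>))"
    unfolding Suc.IH by (simp add: env)
  also have "\<dots> \<longleftrightarrow> (\<exists>zs \<in> lists (carrier A). length zs = Suc n \<and>
        sat A (\<lambda>k. if k < Suc n then zs ! k else e (k - Suc n)) \<phi>)" (is "?l \<longleftrightarrow> ?r")
  proof
    assume ?l
    then obtain zs z where "zs \<in> lists (carrier A)" "length zs = n" "z \<in> carrier A"
      "sat A (\<lambda>k. if k < Suc n then (z # zs) ! k else e (k - Suc n)) \<phi>" by blast
    then show ?r by (intro bexI[of _ "z # zs"]) auto
  next
    assume ?r
    then obtain zs where "zs \<in> lists (carrier A)" "length zs = Suc n"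
      "sat A (\<lambda>k. if k < Suc n then zs ! k else e (k - Suc n)) \<phi>" by blast
    then show ?l by (cases zs) auto
  qed
  finally show ?case .
qed

lemma fv_Ex_funpow: "fv ((Ex ^^ n) \<phi>) = {i. i + n \<in> fv \<phi>}"
  by (induction n arbitrary: \<phi>) (auto simp: funpow_swap1 add.commute)

lemma formulas_Ex_funpow: "\<phi> \<in> formulas L \<Longrightarrow> (Ex ^^ n) \<phi> \<in> formulas L"
  by (induction n) (auto simp: formulas_def)

subsection \<open>Definable predicates\<close>

text \<open>A label \<open>Inl i\<close> is a variable and \<open>Inr c\<close> a parameter; labels
  may come in any order and with repetitions. Speaking of predicates instead of formulas keeps the
  index bookkeeping inside the closure lemmas below.\<close>

definition definable ::
  "('f, 'r) lang \<Rightarrow> ('a, 'f, 'r) struct \<Rightarrow> 'i set \<Rightarrow> 'a set \<Rightarrow> (('i \<Rightarrow> 'a) \<Rightarrow> bool) \<Rightarrow> bool" where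
  "definable L U I C R \<longleftrightarrow> (\<exists>\<phi> u. \<phi> \<in> formulas L \<and> u \<in> lists (I <+> C) \<and> fv \<phi> \<subseteq> {..<length u} \<and>
     (\<forall>a. range a \<subseteq> carrier U \<longrightarrow> (R a \<longleftrightarrow> sat U ((!) (map (case_sum a id) u)) \<phi>)))"

lemma definable_pformula:
  assumes "\<chi> \<in> pformulas L I C"
  shows "definable L U I C (\<lambda>a. psat U a \<chi>)"
proof -
  obtain \<phi> xs c where \<chi>: "\<chi> = (\<phi>, xs, c)" by (cases \<chi>)
  show ?thesis
    unfolding definable_def
    by (rule exI[of _ \<phi>], rule exI[of _ "map Inl xs @ map Inr c"])
      (use assms in \<open>auto simp: \<chi> pformulas_def comp_def\<close>)
qed

lemma sum_list_partition:
  assumes "u \<in> lists (I <+> C)"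
  obtains xs c where "xs \<in> lists I" "c \<in> lists C" "set u = Inl ` set xs \<union> Inr ` set c"
    "distinct xs"
proof -
  have fin: "finite (Inl -` set u)" "finite (Inr -` set u)"
    by (auto intro: finite_vimageI)
  obtain xs where xs: "set xs = Inl -` set u" "distinct xs"
    using finite_distinct_list[OF fin(1)] by blast
  obtain c where c: "set c = Inr -` set u"
    using finite_list[OF fin(2)] by blast
  show thesis
  proof
    show "xs \<in> lists I" "c \<in> lists C" using assms xs c by auto
    show "set u = Inl ` set xs \<union> Inr ` set c"
    proof
      show "set u \<subseteq> Inl ` set xs \<union> Inr ` set c"
      proof
        fix z assume "z \<in> set u"
        with xs c show "z \<in> Inl ` set xs \<union> Inr ` set c" by (cases z rule: sum.exhaust) auto
      qed
    qed (use xs c in auto)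
  qed (use xs in auto)
qed

text \<open>Sorting the labels into variables and parameters recovers the triple form. Distinctness
  of \<open>xs\<close> is recorded so that a list of values for \<open>xs\<close> can later be read
  as an assignment.\<close>

lemma definable_imp_pformula:
  assumes "definable L U I C R"
  obtains \<phi> xs c where "(\<phi>, xs, c) \<in> pformulas L I C" "distinct xs"
    "\<And>a. range a \<subseteq> carrier U \<Longrightarrow> R a \<longleftrightarrow> psat U a (\<phi>, xs, c)"
proof -
  obtain \<phi> u where \<phi>: "\<phi> \<in> formulas L" "fv \<phi> \<subseteq> {..<length u}" and u: "u \<in> lists (I <+> C)"
    and R: "\<And>a. range a \<subseteq> carrier U \<Longrightarrow> R a \<longleftrightarrow> sat U ((!) (map (case_sum a id) u)) \<phi>"
    using assms unfolding definable_def by blast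
  obtain xs c where xs: "xs \<in> lists I" "c \<in> lists C" "set u = Inl ` set xs \<union> Inr ` set c"
    "distinct xs" by (rule sum_list_partition[OF u])
  then have "set u \<subseteq> set (map Inl xs @ map Inr c)" by simp
  then obtain \<psi> where "\<psi> \<in> formulas L" "fv \<psi> \<subseteq> {..<length (map Inl xs @ map Inr c)}"
    and \<psi>: "\<And>h. sat U ((!) (map h (map Inl xs @ map Inr c))) \<psi> \<longleftrightarrow> sat U ((!) (map h u)) \<phi>"
    by (rule reindex_formula[OF \<phi>]) (rule that)
  moreover have "psat U a (\<psi>, xs, c) \<longleftrightarrow> sat U ((!) (map (case_sum a id) u)) \<phi>" for a
    using \<psi>[of "case_sum a id"] by (simp add: comp_def)
  ultimately have "(\<psi>, xs, c) \<in> pformulas L I C"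
    and "\<And>a. range a \<subseteq> carrier U \<Longrightarrow> R a \<longleftrightarrow> psat U a (\<psi>, xs, c)"
    using R xs(1,2) by (auto simp: pformulas_def simp del: psat.simps)
  then show thesis by (rule that[OF _ xs(4)])
qed

section \<open>Closure properties of definability\<close>

lemma definable_mono:
  assumes "definable L U I C R" "I \<subseteq> I'" "C \<subseteq> C'"
  shows "definable L U I' C' R"
proof -
  have "lists (I <+> C) \<subseteq> lists (I' <+> C')" using assms by (intro lists_mono) auto
  then show ?thesis using assms(1) unfolding definable_def by blast
qed

lemma definable_cong:
  assumes "definable L U I C R" "\<And>a. range a \<subseteq> carrier U \<Longrightarrow> R a \<longleftrightarrow> R' a"
  shows "definable L U I C R'"
  using assms unfolding definable_def by (simp only: cong: conj_cong imp_cong)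

lemma definable_finite_vars:
  assumes "definable L U I C R"
  obtains J where "finite J" "J \<subseteq> I" "definable L U J C R"
proof -
  obtain \<phi> xs c where \<chi>: "(\<phi>, xs, c) \<in> pformulas L I C" "distinct xs"
    and R: "\<And>a. range a \<subseteq> carrier U \<Longrightarrow> R a \<longleftrightarrow> psat U a (\<phi>, xs, c)"
    by (rule definable_imp_pformula[OF assms]) (rule that)
  have "(\<phi>, xs, c) \<in> pformulas L (set xs) C" using \<chi> by (auto simp: pformulas_def)
  from definable_pformula[OF this, of U] have "definable L U (set xs) C R"
    by (rule definable_cong) (simp only: R)
  with that[of "set xs"] \<chi> show thesis by (auto simp: pformulas_def)
qed

lemma definable_depends:
  assumes "definable L U I C R" "range a \<subseteq> carrier U" "range a' \<subseteq> carrier U"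
    and "\<And>i. i \<in> I \<Longrightarrow> a i = a' i"
  shows "R a \<longleftrightarrow> R a'"
proof -
  obtain \<phi> u where u: "u \<in> lists (I <+> C)"
    and R: "\<And>a. range a \<subseteq> carrier U \<Longrightarrow> R a \<longleftrightarrow> sat U ((!) (map (case_sum a id) u)) \<phi>"
    using assms(1) unfolding definable_def by blast
  have "map (case_sum a id) u = map (case_sum a' id) u"
    using u assms(4) by (auto split: sum.split)
  then show ?thesis using R[OF assms(2)] R[OF assms(3)] by (simp only:)
qed

lemma definable_neg: "definable L U I C R \<Longrightarrow> definable L U I C (\<lambda>a. \<not> R a)"
  unfolding definable_def
proof (elim exE conjE)
  fix \<phi> u assume "\<phi> \<in> formulas L" "u \<in> lists (I <+> C)" "fv \<phi> \<subseteq> {..<length u}"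
    "\<forall>a. range a \<subseteq> carrier U \<longrightarrow> R a = sat U ((!) (map (case_sum a id) u)) \<phi>"
  then show "\<exists>\<phi> u. \<phi> \<in> formulas L \<and> u \<in> lists (I <+> C) \<and> fv \<phi> \<subseteq> {..<length u} \<and>
     (\<forall>a. range a \<subseteq> carrier U \<longrightarrow> (\<not> R a) = sat U ((!) (map (case_sum a id) u)) \<phi>)"
    by (intro exI[of _ "Neg \<phi>"] exI[of _ u]) (auto simp: formulas_def)
qed

lemma definable_imp:
  assumes "definable L U I C R" "definable L U I C S"
  shows "definable L U I C (\<lambda>a. R a \<longrightarrow> S a)"
proof -
  obtain \<phi> u where \<phi>: "\<phi> \<in> formulas L" "fv \<phi> \<subseteq> {..<length u}" and u: "u \<in> lists (I <+> C)"
    and R: "\<And>a. range a \<subseteq> carrier U \<Longrightarrow> R a \<longleftrightarrow> sat U ((!) (map (case_sum a id) u)) \<phi>"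
    using assms(1) unfolding definable_def by blast
  obtain \<psi> w where \<psi>: "\<psi> \<in> formulas L" "fv \<psi> \<subseteq> {..<length w}" and w: "w \<in> lists (I <+> C)"
    and S: "\<And>a. range a \<subseteq> carrier U \<Longrightarrow> S a \<longleftrightarrow> sat U ((!) (map (case_sum a id) w)) \<psi>"
    using assms(2) unfolding definable_def by blast
  have sub: "set u \<subseteq> set (u @ w)" "set w \<subseteq> set (u @ w)" by simp_all
  obtain \<phi>' where \<phi>': "\<phi>' \<in> formulas L" "fv \<phi>' \<subseteq> {..<length (u @ w)}"
    "\<And>h. sat U ((!) (map h (u @ w))) \<phi>' \<longleftrightarrow> sat U ((!) (map h u)) \<phi>"
    by (rule reindex_formula[OF \<phi> sub(1)]) (rule that)
  obtain \<psi>' where \<psi>': "\<psi>' \<in> formulas L" "fv \<psi>' \<subseteq> {..<length (u @ w)}"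
    "\<And>h. sat U ((!) (map h (u @ w))) \<psi>' \<longleftrightarrow> sat U ((!) (map h w)) \<psi>"
    by (rule reindex_formula[OF \<psi> sub(2)]) (rule that)
  show ?thesis
    unfolding definable_def
  proof (rule exI[of _ "Imp \<phi>' \<psi>'"], rule exI[of _ "u @ w"], intro conjI allI impI)
    show "Imp \<phi>' \<psi>' \<in> formulas L" using \<phi>'(1) \<psi>'(1) by (simp add: formulas_def)
    show "u @ w \<in> lists (I <+> C)" using u w by simp
    show "fv (Imp \<phi>' \<psi>') \<subseteq> {..<length (u @ w)}" using \<phi>'(2) \<psi>'(2) by simp
  qed (simp only: R S \<phi>'(3) \<psi>'(3) sat.simps)
qed

lemma definable_conj:
  assumes "definable L U I C R" "definable L U I C S"
  shows "definable L U I C (\<lambda>a. R a \<and> S a)"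
  using definable_neg[OF definable_imp[OF assms(1) definable_neg[OF assms(2)]]] by simp

lemma definable_True: "definable L U I C (\<lambda>a. True)"
  unfolding definable_def
  by (rule exI[of _ "Neg Fls"], rule exI[of _ "[]"]) (auto simp: formulas_def)

lemma definable_Ball:
  assumes "finite F" "\<And>x. x \<in> F \<Longrightarrow> definable L U I C (R x)"
  shows "definable L U I C (\<lambda>a. \<forall>x\<in>F. R x a)"
  using assms by (induction F) (auto simp: definable_True intro: definable_conj)

lemma definable_Bex:
  assumes "finite F" "\<And>x. x \<in> F \<Longrightarrow> definable L U I C (R x)"
  shows "definable L U I C (\<lambda>a. \<exists>x\<in>F. R x a)"
  using definable_neg[OF definable_Ball[OF assms(1) definable_neg[OF assms(2)]]] by simp

text \<open>Substitution of variables. With \<open>f = Pair g\<close> it copies \<open>R\<close>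
  into a block of variables marked by \<open>g\<close>, so that several tuples can be handled as
  one.\<close>

lemma definable_reindex:
  fixes U :: "('a, 'f, 'r) struct" and f :: "'i \<Rightarrow> 'j"
  assumes "definable L U I C R" "f ` I \<subseteq> J"
  shows "definable L U J C (\<lambda>a. R (a \<circ> f))"
proof -
  obtain \<phi> u where \<phi>: "\<phi> \<in> formulas L" "fv \<phi> \<subseteq> {..<length u}" and u: "u \<in> lists (I <+> C)"
    and R: "\<And>a. range a \<subseteq> carrier U \<Longrightarrow> R a \<longleftrightarrow> sat U ((!) (map (case_sum a id) u)) \<phi>"
    using assms(1) unfolding definable_def by blast
  have eq: "map (case_sum a id) (map (map_sum f id) u) = map (case_sum (a \<circ> f) id) u"
    for a :: "'j \<Rightarrow> 'a"
    by (auto split: sum.split)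
  have "map_sum f id ` (I <+> C) \<subseteq> J <+> C" using assms(2) by auto
  then have u': "map (map_sum f id) u \<in> lists (J <+> C)" using u by (force simp: in_lists_conv_set)
  have ran: "range (a \<circ> f) \<subseteq> carrier U" if "range a \<subseteq> carrier U" for a using that by auto
  show ?thesis
    unfolding definable_def
    using \<phi> u' R[OF ran]
    by (intro exI[of _ \<phi>] exI[of _ "map (map_sum f id) u"] conjI allI impI) (simp_all only: eq length_map)
qed

text \<open>Although \<open>v\<close> ranges over whole functions, the quantifier is first-order:
  only the finitely many coordinates \<open>ws\<close> occur in the formula, and the others can be
  filled with any element of the carrier.\<close>

lemma definable_Ex:
  fixes U :: "('a, 'f, 'r) struct" and R :: "('i + 'j \<Rightarrow> 'a) \<Rightarrow> bool"
  assumes "definable L U (I <+> J) C R" and ne: "carrier U \<noteq> {}"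
  shows "definable L U I C (\<lambda>a. \<exists>v. range v \<subseteq> carrier U \<and> R (case_sum a v))"
proof -
  obtain \<phi> zs c where \<chi>: "(\<phi>, zs, c) \<in> pformulas L (I <+> J) C" "distinct zs"
    and R: "\<And>a. range a \<subseteq> carrier U \<Longrightarrow> R a \<longleftrightarrow> psat U a (\<phi>, zs, c)"
    by (rule definable_imp_pformula[OF assms(1)]) (rule that)
  then have zs: "zs \<in> lists (I <+> J)" and c: "c \<in> lists C" and \<phi>: "\<phi> \<in> formulas L"
    "fv \<phi> \<subseteq> {..<length (map Inl zs @ map Inr c)}"
    by (auto simp: pformulas_def)
  obtain ws where ws: "distinct ws" "set ws = Inr -` set zs"
    using finite_distinct_list[OF finite_vimageI[OF finite_set[of zs] inj_Inr]] by auto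
  obtain xs where xs: "set xs = Inl -` set zs"
    using finite_list[OF finite_vimageI[OF finite_set[of zs] inj_Inl]] by auto
  \<comment> \<open>The quantified variables come first, because the block of quantifiers binds
    exactly the indices below its length.\<close>
  let ?u = "map (Inl \<circ> Inr) ws @ map (Inl \<circ> Inl) xs @ map Inr c"
  have "set zs \<subseteq> Inl ` set xs \<union> Inr ` set ws"
  proof
    fix z assume "z \<in> set zs"
    with xs ws show "z \<in> Inl ` set xs \<union> Inr ` set ws" by (cases z rule: sum.exhaust) auto
  qed
  then have "set (map Inl zs @ map Inr c) \<subseteq> Inl ` (Inl ` set xs \<union> Inr ` set ws) \<union> Inr ` set c"
    by auto
  also have "\<dots> = set ?u" by (simp add: image_Un image_comp Un_commute Un_left_commute)
  finally have "set (map Inl zs @ map Inr c) \<subseteq> set ?u" .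
  then obtain \<psi> where \<psi>: "\<psi> \<in> formulas L" "fv \<psi> \<subseteq> {..<length ?u}"
    "\<And>h. sat U ((!) (map h ?u)) \<psi> \<longleftrightarrow> sat U ((!) (map h (map Inl zs @ map Inr c))) \<phi>"
    by (rule reindex_formula[OF \<phi>]) (rule that)
  let ?n = "length ws" and ?t = "map Inl xs @ map Inr c"
  have R': "R (case_sum a v) \<longleftrightarrow>
      sat U (\<lambda>k. if k < ?n then map v ws ! k else map (case_sum a id) ?t ! (k - ?n)) \<psi>"
    if "range a \<subseteq> carrier U" "range v \<subseteq> carrier U" for a v
  proof -
    have "case_sum a v z \<in> carrier U" for z using that by (cases z) auto
    then have "range (case_sum a v) \<subseteq> carrier U" by blast
    then have "R (case_sum a v) \<longleftrightarrow> sat U ((!) (map (case_sum (case_sum a v) id) (map Inl zs @ map Inr c))) \<phi>"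
      using R by (simp add: comp_def)
    also have "\<dots> \<longleftrightarrow> sat U ((!) (map (case_sum (case_sum a v) id) ?u)) \<psi>"
      by (simp only: \<psi>(3))
    also have "map (case_sum (case_sum a v) id) ?u = map v ws @ map (case_sum a id) ?t"
      by simp
    also have "(!) (map v ws @ map (case_sum a id) ?t) =
        (\<lambda>k. if k < ?n then map v ws ! k else map (case_sum a id) ?t ! (k - ?n))"
      by (simp only: fun_eq_iff nth_append length_map simp_thms)
    finally show ?thesis .
  qed
  show ?thesis
    unfolding definable_def
  proof (rule exI[of _ "(Ex ^^ ?n) \<psi>"], rule exI[of _ ?t], intro conjI allI impI)
    show "(Ex ^^ ?n) \<psi> \<in> formulas L" using \<psi>(1) by (rule formulas_Ex_funpow)
    have "set xs \<subseteq> I" using zs xs by (auto simp: in_lists_conv_set)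
    then show "?t \<in> lists (I <+> C)" using c by (auto simp: in_lists_conv_set)
    show "fv ((Ex ^^ ?n) \<psi>) \<subseteq> {..<length ?t}" using \<psi>(2) by (auto simp: fv_Ex_funpow)
    fix a :: "'i \<Rightarrow> 'a" assume a: "range a \<subseteq> carrier U"
    show "(\<exists>v. range v \<subseteq> carrier U \<and> R (case_sum a v)) \<longleftrightarrow>
       sat U ((!) (map (case_sum a id) ?t)) ((Ex ^^ ?n) \<psi>)"
      unfolding sat_Ex_funpow
    proof
      assume "\<exists>v. range v \<subseteq> carrier U \<and> R (case_sum a v)"
      then obtain v where v: "range v \<subseteq> carrier U" "R (case_sum a v)" by blast
      then show "\<exists>zs\<in>lists (carrier U). length zs = ?n \<and>
        sat U (\<lambda>k. if k < ?n then zs ! k else map (case_sum a id) ?t ! (k - ?n)) \<psi>"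
        unfolding R'[OF a v(1)] using v(1) by (intro bexI[of _ "map v ws"]) (auto simp only: length_map in_lists_conv_set set_map)
    next
      assume "\<exists>zs\<in>lists (carrier U). length zs = ?n \<and>
        sat U (\<lambda>k. if k < ?n then zs ! k else map (case_sum a id) ?t ! (k - ?n)) \<psi>"
      then obtain ys where ys: "ys \<in> lists (carrier U)" "length ys = ?n"
        "sat U (\<lambda>k. if k < ?n then ys ! k else map (case_sum a id) ?t ! (k - ?n)) \<psi>" by blast
      \<comment> \<open>A value for the coordinates that the formula does not mention.\<close>
      obtain x0 where x0: "x0 \<in> carrier U" using ne by blast
      define v where "v y = (case map_of (zip ws ys) y of None \<Rightarrow> x0 | Some z \<Rightarrow> z)" for y
      have "v y \<in> carrier U" for y
        using x0 ys(1) by (auto simp: v_def split: option.split dest!: map_of_SomeD set_zip_rightD)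
      then have v: "range v \<subseteq> carrier U" by blast
      have "map v ws = ys"
        using ws(1) ys(2) by (intro nth_equalityI) (auto simp: v_def map_of_zip_nth)
      then show "\<exists>v. range v \<subseteq> carrier U \<and> R (case_sum a v)"
        using R'[OF a v] v ys(3) by (simp only:) blast
    qed
  qed
qed

text \<open>The existential closure over the finitely many variables that occur is true in
  \<open>U\<close>, hence in \<open>M\<close>. There it supplies witnesses, and elementarity carries
  their truth back up to \<open>U\<close>.\<close>

lemma elementary_submodel_realizes:
  assumes "elementary_submodel L M U" and "definable L U I (carrier M) R"
    and "range a \<subseteq> carrier U" "R a"
  obtains m where "range m \<subseteq> carrier M" "R m"
proof -
  have MU: "carrier M \<subseteq> carrier U" and ne: "carrier M \<noteq> {}"
    and el: "\<And>\<phi> e. \<phi> \<in> formulas L \<Longrightarrow> range e \<subseteq> carrier M \<Longrightarrow> sat M e \<phi> \<longleftrightarrow> sat U e \<phi>"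
    using assms(1) by (auto simp: elementary_submodel_def structure_for_def)
  obtain m0 where m0: "m0 \<in> carrier M" using ne by blast
  obtain \<phi> xs c where \<chi>: "(\<phi>, xs, c) \<in> pformulas L I (carrier M)" "distinct xs"
    and R: "\<And>a. range a \<subseteq> carrier U \<Longrightarrow> R a \<longleftrightarrow> psat U a (\<phi>, xs, c)"
    by (rule definable_imp_pformula[OF assms(2)]) (rule that)
  have \<phi>: "\<phi> \<in> formulas L" "fv \<phi> \<subseteq> {..<length xs + length c}" and c: "c \<in> lists (carrier M)"
    using \<chi> by (auto simp: pformulas_def)
  let ?n = "length xs"
  \<comment> \<open>Elementarity speaks of assignments with all values in \<open>M\<close>, so the
    finite list \<open>c\<close> is padded by \<open>m0\<close>.\<close>
  define e where "e k = (if k < length c then c ! k else m0)" for k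
  have e: "range e \<subseteq> carrier M" using c m0 by (auto simp: e_def)
  have psat: "psat U b (\<phi>, xs, c) \<longleftrightarrow> sat U (\<lambda>k. if k < ?n then map b xs ! k else e (k - ?n)) \<phi>" for b
    unfolding psat.simps by (rule sat_cong) (use \<phi>(2) in \<open>auto simp: e_def nth_append\<close>)
  have "sat U e ((Ex ^^ ?n) \<phi>)"
    unfolding sat_Ex_funpow using R[OF assms(3)] assms(3,4)
    by (intro bexI[of _ "map a xs"]) (auto simp: psat range_subsetD simp del: psat.simps)
  then have "sat M e ((Ex ^^ ?n) \<phi>)"
    using el[OF formulas_Ex_funpow[OF \<phi>(1)] e] by simp
  then obtain ys where ys: "ys \<in> lists (carrier M)" "length ys = ?n"
    "sat M (\<lambda>k. if k < ?n then ys ! k else e (k - ?n)) \<phi>"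
    unfolding sat_Ex_funpow by blast
  have "range (\<lambda>k. if k < ?n then ys ! k else e (k - ?n)) \<subseteq> carrier M"
    using ys e by auto
  then have sat: "sat U (\<lambda>k. if k < ?n then ys ! k else e (k - ?n)) \<phi>"
    using el[OF \<phi>(1)] ys(3) by blast
  define m where "m y = (case map_of (zip xs ys) y of None \<Rightarrow> m0 | Some z \<Rightarrow> z)" for y
  have "m y \<in> carrier M" for y
    using m0 ys(1) by (auto simp: m_def split: option.split dest!: map_of_SomeD set_zip_rightD)
  then have m: "range m \<subseteq> carrier M" by blast
  have "map m xs = ys"
    using \<chi>(2) ys(2) by (intro nth_equalityI) (auto simp: m_def map_of_zip_nth)
  then have "psat U m (\<phi>, xs, c)" using sat by (simp only: psat)
  moreover have "range m \<subseteq> carrier U" using m MU by blast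
  ultimately have "R m" by (simp only: R)
  with m show thesis by (rule that)
qed

subsection \<open>Covering by sets with many disjoint translates\<close>

text \<open>The covering argument needs nothing from model theory but a group. Later the points are
  assignments, moved by the automorphisms over \<open>M\<close>; translates are taken as preimages,
  which commute with all set operations.\<close>

locale permutation_group =
  fixes G :: "('y \<Rightarrow> 'y) set"
  assumes id_mem: "id \<in> G"
    and comp_mem: "g \<in> G \<Longrightarrow> h \<in> G \<Longrightarrow> g \<circ> h \<in> G"
    and inverse_mem: "g \<in> G \<Longrightarrow> \<exists>h\<in>G. g \<circ> h = id \<and> h \<circ> g = id"
begin

text \<open>The translate by \<open>h\<close> is chosen after the finite family \<open>F\<close> and
  serves all its members at once; this is the genericity of a new Morley sequence over given ones.
  Each rank accounts for one doubling of the number of intersected instances.\<close>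

primrec evasive :: "nat \<Rightarrow> 'y set \<Rightarrow> bool" where
  "evasive 0 = (\<lambda>P. P = {})"
| "evasive (Suc n) = (\<lambda>P. \<forall>F. finite F \<and> F \<subseteq> G \<longrightarrow>
     (\<exists>h\<in>G. \<forall>g\<in>F. evasive n (h -` P \<inter> g -` P)))"

definition quasi_divides :: "'y set \<Rightarrow> bool" where
  "quasi_divides A \<longleftrightarrow> (\<exists>F. finite F \<and> F \<subseteq> G \<and> (\<Inter>g\<in>F. g -` A) = {})"

text \<open>Translates of a translate of \<open>P\<close> are translates of \<open>P\<close>: apply
  the rank of \<open>P\<close> to the family shifted by \<open>h\<close>, then undo the shift with
  the inverse \<open>h'\<close>.\<close>

lemma evasive_vimage:
  assumes "evasive n P" "h \<in> G"
  shows "evasive n (h -` P)"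
proof (cases n)
  case 0
  with assms show ?thesis by simp
next
  case (Suc n)
  obtain h' where h': "h' \<in> G" "h \<circ> h' = id" using inverse_mem[OF assms(2)] by blast
  have "\<exists>h1\<in>G. \<forall>g\<in>F. evasive n (h1 -` h -` P \<inter> g -` h -` P)" if F: "finite F" "F \<subseteq> G" for F
  proof -
    have "finite ((\<lambda>g. h \<circ> g) ` F)" "(\<lambda>g. h \<circ> g) ` F \<subseteq> G"
      using F assms(2) comp_mem by auto
    with assms(1) Suc obtain k where k: "k \<in> G"
      "\<forall>g\<in>(\<lambda>g. h \<circ> g) ` F. evasive n (k -` P \<inter> g -` P)" by auto
    have "(h' \<circ> k) -` h -` P = k -` P"
      using h'(2) by (simp add: vimage_def fun_eq_iff)
    then have "\<forall>g\<in>F. evasive n ((h' \<circ> k) -` h -` P \<inter> g -` h -` P)"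
      using k(2) by (auto simp: vimage_comp)
    then show ?thesis using comp_mem[OF h'(1) k(1)] by blast
  qed
  then show ?thesis using Suc by simp
qed

text \<open>The induction statement, depending on the ranks alone. Both \<open>A\<close> and its
  cover change in the induction step, so they are quantified inside.\<close>

definition covered_ranks :: "nat list \<Rightarrow> bool" where
  "covered_ranks ns \<longleftrightarrow>
     (\<forall>Ps A. list_all2 evasive ns Ps \<and> A \<subseteq> \<Union> (set Ps) \<longrightarrow> quasi_divides A)"

text \<open>If \<open>A \<subseteq> P \<union> Q\<close>, where sets covered like \<open>Q\<close> quasi-divide, then finitely many translates of
  \<open>A - P\<close> have empty intersection, so the intersection of the same translates of \<open>A\<close> is covered
  by translates of \<open>P\<close>. Intersecting with one more translate of \<open>A\<close>, chosen generically over
  them, lowers the rank of \<open>P\<close>.\<close>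

lemma covered_ranks_Suc:
  assumes "covered_ranks ns" and "\<And>m. covered_ranks (replicate m n @ ns)"
  shows "covered_ranks (Suc n # ns)"
  unfolding covered_ranks_def
proof (intro allI impI, elim conjE)
  fix Qs A assume "list_all2 evasive (Suc n # ns) Qs" and A: "A \<subseteq> \<Union> (set Qs)"
  then obtain P Ps where Qs: "Qs = P # Ps" and P: "evasive (Suc n) P" and Ps: "list_all2 evasive ns Ps"
    by (auto simp: list_all2_Cons1)
  have "A - P \<subseteq> \<Union> (set Ps)" using A Qs by auto
  then have "quasi_divides (A - P)" using assms(1) Ps unfolding covered_ranks_def by blast
  then obtain F where F: "finite F" "F \<subseteq> G" "(\<Inter>g\<in>F. g -` (A - P)) = {}"
    unfolding quasi_divides_def by blast
  from P F(1,2) obtain h where h: "h \<in> G" "\<forall>g\<in>F. evasive n (h -` P \<inter> g -` P)" by auto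
  obtain gs where gs: "set gs = F" using finite_list[OF F(1)] by blast
  define A' where "A' = h -` A \<inter> (\<Inter>g\<in>F. g -` A)"
  let ?Qs = "map (\<lambda>g. h -` P \<inter> g -` P) gs @ map (vimage h) Ps"
  have "list_all2 evasive (replicate (length gs) n @ ns) ?Qs"
  proof (rule list_all2_appendI)
    show "list_all2 evasive (replicate (length gs) n) (map (\<lambda>g. h -` P \<inter> g -` P) gs)"
      using h(2) gs by (auto simp: list_all2_conv_all_nth)
    show "list_all2 evasive ns (map (vimage h) Ps)"
      using Ps evasive_vimage[OF _ h(1)] by (auto simp: list_all2_conv_all_nth)
  qed
  moreover have "A' \<subseteq> \<Union> (set ?Qs)"
  proof
    fix x assume x: "x \<in> A'"
    then have hx: "h x \<in> A" and gx: "\<And>g. g \<in> F \<Longrightarrow> g x \<in> A" by (auto simp: A'_def)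
    \<comment> \<open>Some \<open>g x\<close> lies in \<open>A\<close> but not in
      \<open>A - P\<close>, hence in \<open>P\<close>. If \<open>h x\<close> is in \<open>P\<close>
      too, then \<open>x\<close> is in the piece of rank \<open>n\<close> belonging to
      \<open>g\<close>; otherwise \<open>h x\<close> is in a member of \<open>Ps\<close>.\<close>
    have "x \<notin> (\<Inter>g\<in>F. g -` (A - P))" using F(3) by simp
    then obtain g where "g \<in> F" "g x \<in> P" using gx by auto
    then show "x \<in> \<Union> (set ?Qs)" using hx A Qs gs by auto
  qed
  ultimately have "quasi_divides A'"
    using assms(2)[of "length gs"] unfolding covered_ranks_def by blast
  then obtain F' where F': "finite F'" "F' \<subseteq> G" "(\<Inter>g\<in>F'. g -` A') = {}"
    unfolding quasi_divides_def by blast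
  \<comment> \<open>\<open>A'\<close> is itself the intersection of the translates of
    \<open>A\<close> by \<open>insert h F\<close>, so translates of \<open>A'\<close> unfold into
    translates of \<open>A\<close> by composites.\<close>
  let ?F = "(\<lambda>(k, g). k \<circ> g) ` (insert h F \<times> F')"
  have "(\<Inter>g\<in>?F. g -` A) \<subseteq> (\<Inter>g\<in>F'. g -` A')"
    by (auto simp: A'_def)
  moreover have "?F \<subseteq> G" using F(2) F'(2) h(1) comp_mem by auto
  moreover have "finite ?F" using F(1) F'(1) by blast
  ultimately show "quasi_divides A"
    unfolding quasi_divides_def using F'(3) by (intro exI[of _ ?F]) simp
qed

lemma covered_ranks_0:
  assumes "covered_ranks ns"
  shows "covered_ranks (0 # ns)"
  unfolding covered_ranks_def
proof (intro allI impI, elim conjE)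
  fix Qs A assume "list_all2 evasive (0 # ns) Qs" and A: "A \<subseteq> \<Union> (set Qs)"
  then obtain Ps where "Qs = {} # Ps" and "list_all2 evasive ns Ps"
    by (auto simp: list_all2_Cons1)
  with A assms show "quasi_divides A" unfolding covered_ranks_def by simp
qed

text \<open>One set of rank \<open>n + 1\<close> is traded for any number of sets of rank
  \<open>n\<close>. The well-founded multiset order behind this becomes an induction on the rank
  with an inner one on the multiplicity; \<open>ns\<close> is arbitrary because further sets of rank
  \<open>n + 1\<close> stay in the list while those of rank \<open>n\<close> are added.\<close>

lemma covered_ranks_replicate:
  "covered_ranks ns \<Longrightarrow> covered_ranks (replicate m n @ ns)"
proof (induction n arbitrary: ns m)
  case 0
  then show ?case by (induction m) (simp_all add: covered_ranks_0)
next
  case (Suc n)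
  note IH = this
  show ?case
  proof (induction m)
    case 0
    show ?case using IH(2) by simp
  next
    case (Suc m)
    show ?case
      using covered_ranks_Suc[OF Suc IH(1)[OF Suc]] by simp
  qed
qed

lemma covered_ranks: "covered_ranks ns"
proof (induction ns)
  case Nil
  \<comment> \<open>With no covering sets \<open>A\<close> is empty. An intersection over the empty
    family would be everything, so the identity is used.\<close>
  show ?case unfolding covered_ranks_def quasi_divides_def
    by (auto intro!: exI[of _ "{id}"] simp: id_mem)
next
  case (Cons n ns)
  from covered_ranks_replicate[OF this, of 1 n] show ?case by simp
qed

text \<open>The ideal generated by the ranked sets. Finite unions stay in it by construction, and
  its members quasi-divide by \<open>covered_ranks\<close>.\<close>

definition small :: "'y set \<Rightarrow> bool" where
  "small A \<longleftrightarrow> (\<exists>\<P>. finite \<P> \<and> (\<forall>P\<in>\<P>. \<exists>n. evasive n P) \<and> A \<subseteq> \<Union>\<P>)"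

lemma small_quasi_divides:
  assumes "small A"
  shows "quasi_divides A"
proof -
  obtain \<P> where \<P>: "finite \<P>" "\<forall>P\<in>\<P>. \<exists>n. evasive n P" "A \<subseteq> \<Union>\<P>"
    using assms unfolding small_def by blast
  obtain Ps where Ps: "set Ps = \<P>" using finite_list[OF \<P>(1)] by blast
  obtain r where r: "\<forall>P\<in>\<P>. evasive (r P) P" using \<P>(2) by metis
  have "list_all2 evasive (map r Ps) Ps"
    using r Ps by (auto simp: list_all2_conv_all_nth)
  then show ?thesis using covered_ranks[of "map r Ps"] \<P>(3) Ps unfolding covered_ranks_def by blast
qed

lemma small_vimage:
  assumes "small A" "g \<in> G"
  shows "small (g -` A)"
proof -
  obtain \<P> where \<P>: "finite \<P>" "\<forall>P\<in>\<P>. \<exists>n. evasive n P" "A \<subseteq> \<Union>\<P>"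
    using assms unfolding small_def by blast
  have "\<forall>P\<in>vimage g ` \<P>. \<exists>n. evasive n P" using \<P>(2) evasive_vimage[OF _ assms(2)] by blast
  moreover have "g -` A \<subseteq> \<Union>(vimage g ` \<P>)" using \<P>(3) by blast
  ultimately show ?thesis unfolding small_def using \<P>(1) by blast
qed

lemma small_Un:
  assumes "small A" "small B"
  shows "small (A \<union> B)"
proof -
  obtain \<P> where "finite \<P>" "\<forall>P\<in>\<P>. \<exists>n. evasive n P" "A \<subseteq> \<Union>\<P>"
    using assms(1) unfolding small_def by blast
  moreover obtain \<Q> where "finite \<Q>" "\<forall>P\<in>\<Q>. \<exists>n. evasive n P" "B \<subseteq> \<Union>\<Q>"
    using assms(2) unfolding small_def by blast
  ultimately show ?thesis
    unfolding small_def by (intro exI[of _ "\<P> \<union> \<Q>"]) auto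
qed

lemma small_UN:
  assumes "finite S" "\<And>s. s \<in> S \<Longrightarrow> small (A s)"
  shows "small (\<Union>s\<in>S. A s)"
  using assms
proof (induction S)
  case empty
  show ?case unfolding small_def by (intro exI[of _ "{}"]) simp
qed (simp add: small_Un)

end

subsection \<open>Ultrafilters\<close>

definition ultrafilter :: "'b set set \<Rightarrow> bool" where
  "ultrafilter \<D> \<longleftrightarrow> (\<forall>X\<in>\<D>. \<forall>Y\<in>\<D>. X \<inter> Y \<in> \<D>) \<and> (\<forall>X\<in>\<D>. \<forall>Y. X \<subseteq> Y \<longrightarrow> Y \<in> \<D>) \<and>
     (\<forall>X. - X \<in> \<D> \<longleftrightarrow> X \<notin> \<D>)"

lemma ultrafilter_Int: "ultrafilter \<D> \<Longrightarrow> X \<in> \<D> \<Longrightarrow> Y \<in> \<D> \<Longrightarrow> X \<inter> Y \<in> \<D>"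
  by (simp add: ultrafilter_def)

lemma ultrafilter_mono: "ultrafilter \<D> \<Longrightarrow> X \<in> \<D> \<Longrightarrow> X \<subseteq> Y \<Longrightarrow> Y \<in> \<D>"
  unfolding ultrafilter_def by (elim conjE) blast

lemma ultrafilter_Compl: "ultrafilter \<D> \<Longrightarrow> - X \<in> \<D> \<longleftrightarrow> X \<notin> \<D>"
  by (simp add: ultrafilter_def)

lemma ultrafilter_UNIV: "ultrafilter \<D> \<Longrightarrow> UNIV \<in> \<D>"
  using ultrafilter_Compl[of \<D> UNIV] ultrafilter_mono[of \<D> "- UNIV" UNIV] by blast

lemma ultrafilter_nonempty: "ultrafilter \<D> \<Longrightarrow> X \<in> \<D> \<Longrightarrow> X \<noteq> {}"
  using ultrafilter_UNIV[of \<D>] ultrafilter_Compl[of \<D> UNIV] by auto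

lemma ultrafilter_INT:
  assumes "ultrafilter \<D>" "finite F" "\<And>x. x \<in> F \<Longrightarrow> S x \<in> \<D>"
  shows "(\<Inter>x\<in>F. S x) \<in> \<D>"
  using assms(2,3)
  by (induction F) (simp_all add: ultrafilter_UNIV[OF assms(1)] ultrafilter_Int[OF assms(1)])

text \<open>Zorn's lemma for the families with the finite intersection property that contain the
  given filter base.\<close>

lemma ultrafilter_exists:
  assumes UNIV: "UNIV \<in> \<B>" and Int: "\<And>X Y. X \<in> \<B> \<Longrightarrow> Y \<in> \<B> \<Longrightarrow> X \<inter> Y \<in> \<B>" and ne: "{} \<notin> \<B>"
  obtains \<D> where "ultrafilter \<D>" "\<B> \<subseteq> \<D>"
proof -
  define fip where "fip C \<longleftrightarrow> (\<forall>F. finite F \<longrightarrow> F \<subseteq> C \<longrightarrow> \<Inter>F \<noteq> {})" for C :: "'a set set"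
  define \<A> where "\<A> = {C. \<B> \<subseteq> C \<and> fip C}"
  have "\<Inter>F \<in> \<B>" if "finite F" "F \<subseteq> \<B>" for F
    using that by (induction F rule: finite_induct) (simp_all add: UNIV Int)
  then have "fip \<B>" unfolding fip_def using ne by metis
  then have "\<B> \<in> \<A>" by (simp add: \<A>_def)
  moreover have "\<Union>C \<in> \<A>" if C: "C \<noteq> {}" "subset.chain \<A> C" for C
  proof -
    have "\<Inter>F \<noteq> {}" if F: "finite F" "F \<subseteq> \<Union>C" for F
    proof -
      obtain X where "X \<in> C" "F \<subseteq> X"
        using finite_subset_Union_chain[OF F C] by blast
      moreover from this(1) have "X \<in> \<A>" using C(2) unfolding subset.chain_def by blast
      ultimately show ?thesis using F(1) by (simp add: \<A>_def fip_def)
    qed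
    then have "fip (\<Union>C)" by (simp add: fip_def)
    moreover have "\<B> \<subseteq> \<Union>C" using C unfolding subset.chain_def \<A>_def by blast
    ultimately show ?thesis by (simp add: \<A>_def)
  qed
  ultimately obtain \<D> where D: "\<D> \<in> \<A>" "\<forall>X\<in>\<A>. \<D> \<subseteq> X \<longrightarrow> X = \<D>"
    using subset_Zorn_nonempty[of \<A>] by blast
  have fipD: "\<Inter>F \<noteq> {}" if "finite F" "F \<subseteq> \<D>" for F
    using D(1) that by (simp add: \<A>_def fip_def)
  \<comment> \<open>The form in which maximality is used: a set that meets all finite intersections
    of members can be added, hence is a member.\<close>
  have memI: "X \<in> \<D>" if X: "\<And>F. finite F \<Longrightarrow> F \<subseteq> \<D> \<Longrightarrow> \<Inter>F \<inter> X \<noteq> {}" for X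
  proof -
    have "\<Inter>F \<noteq> {}" if F: "finite F" "F \<subseteq> insert X \<D>" for F
    proof -
      have "\<Inter>(F - {X}) \<inter> X \<noteq> {}" using F by (intro X) auto
      then show ?thesis by blast
    qed
    then have "fip (insert X \<D>)" by (simp add: fip_def)
    then have "insert X \<D> \<in> \<A>" using D(1) by (auto simp: \<A>_def)
    then show ?thesis using D(2) by blast
  qed
  have "ultrafilter \<D>"
    unfolding ultrafilter_def
  proof (intro conjI ballI allI impI)
    fix X Y assume XY: "X \<in> \<D>" "Y \<in> \<D>"
    show "X \<inter> Y \<in> \<D>"
    proof (rule memI)
      fix F assume "finite F" "F \<subseteq> \<D>"
      then have "\<Inter>(insert X (insert Y F)) \<noteq> {}" using XY by (intro fipD) auto
      then show "\<Inter>F \<inter> (X \<inter> Y) \<noteq> {}" by auto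
    qed
  next
    fix X Y assume XY: "X \<in> \<D>" "X \<subseteq> Y"
    show "Y \<in> \<D>"
    proof (rule memI)
      fix F assume "finite F" "F \<subseteq> \<D>"
      then have "\<Inter>(insert X F) \<noteq> {}" using XY by (intro fipD) auto
      then show "\<Inter>F \<inter> Y \<noteq> {}" using XY(2) by auto
    qed
  next
    fix X
    show "- X \<in> \<D> \<longleftrightarrow> X \<notin> \<D>"
    proof
      assume "- X \<in> \<D>"
      then show "X \<notin> \<D>" using fipD[of "{X, - X}"] by auto
    next
      assume "X \<notin> \<D>"
      then obtain F0 where F0: "finite F0" "F0 \<subseteq> \<D>" "\<Inter>F0 \<inter> X = {}" using memI[of X] by auto
      show "- X \<in> \<D>"
      proof (rule memI)
        fix F assume "finite F" "F \<subseteq> \<D>"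
        then have "\<Inter>(F \<union> F0) \<noteq> {}" using F0(1,2) by (intro fipD) auto
        then show "\<Inter>F \<inter> - X \<noteq> {}" using F0(3) by auto
      qed
    qed
  qed
  moreover have "\<B> \<subseteq> \<D>" using D(1) unfolding \<A>_def by blast
  ultimately show thesis by (rule that)
qed

subsection \<open>Automorphisms over the submodel\<close>

text \<open>This makes \<kappa> infinite, so that finitely many parameters can be added to
  \<open>M\<close> without losing smallness.\<close>

lemma infinite_formulas:
  fixes L :: "('a, 'b) lang"
  shows "infinite (formulas L)"
proof -
  have "size ((All ^^ n) Fls :: ('a, 'b) fm) = size (Fls :: ('a, 'b) fm) + n" for n by (induction n) auto
  then have "inj (\<lambda>n. (All ^^ n) Fls :: ('a, 'b) fm)" 
    by (intro inj_on_inverseI[where g = "\<lambda>\<phi>. size \<phi> - size (Fls :: ('a, 'b) fm)"]) simp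
  moreover have "(All ^^ n) Fls \<in> formulas L" for n by (induction n) (auto simp: formulas_def)
  ultimately show ?thesis
    using infinite_iff_countable_subset by blast
qed

locale monster_pair =
  fixes L :: "('f, 'r) lang" and U M :: "('a, 'f, 'r) struct" and \<kappa> :: "'k rel"
  assumes elementary: "elementary_submodel L M U"
    and card_order: "Card_order \<kappa>"
    and formulas_small: "|formulas L| <o \<kappa>"
    and submodel_small: "|carrier M| <o \<kappa>"
    and saturated: "saturated L \<kappa> U"
    and homogeneous: "strongly_homogeneous L \<kappa> U"
begin

lemma structure_U: "structure_for L U" and submodel_subset: "carrier M \<subseteq> carrier U"
  and submodel_nonempty: "carrier M \<noteq> {}"
  using elementary by (auto simp: elementary_submodel_def structure_for_def)

lemma small_parameters:
  assumes "finite Z"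
  shows "|carrier M \<union> Z| <o \<kappa>"
proof -
  have "infinite (Field \<kappa>)"
  proof
    assume "finite (Field \<kappa>)"
    moreover have "|formulas L| \<le>o |Field \<kappa>|"
      using formulas_small card_of_Field_ordIso[OF card_order]
      by (meson ordIso_symmetric ordLess_imp_ordLeq ordLeq_ordIso_trans)
    ultimately show False using infinite_formulas card_of_ordLeq_finite by blast
  qed
  moreover from this have "|Z| <o \<kappa>"
    using assms card_order
    by (metis Field_card_of card_of_Well_order card_order_on_well_order_on finite_ordLess_infinite)
  ultimately show ?thesis
    using card_of_Un_ordLess_infinite_Field card_order submodel_small by blast
qed

text \<open>Being the identity off the carrier makes each member a bijection of the whole type, so
  that \<open>inv\<close> is a true inverse and the members form a group under composition.\<close>

definition Aut :: "('a \<Rightarrow> 'a) set" where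
  "Aut = {\<sigma>. automorphism L U \<sigma> \<and> (\<forall>x\<in>carrier M. \<sigma> x = x) \<and> (\<forall>x. x \<notin> carrier U \<longrightarrow> \<sigma> x = x)}"

lemma Aut_fixes: "\<sigma> \<in> Aut \<Longrightarrow> x \<in> carrier M \<Longrightarrow> \<sigma> x = x"
  by (simp add: Aut_def)

lemma Aut_carrier: "\<sigma> \<in> Aut \<Longrightarrow> \<sigma> x \<in> carrier U \<longleftrightarrow> x \<in> carrier U"
  by (cases "x \<in> carrier U") (auto simp: Aut_def automorphism_def bij_betw_def)

lemma Aut_range: "\<sigma> \<in> Aut \<Longrightarrow> range (\<sigma> \<circ> v) \<subseteq> carrier U \<longleftrightarrow> range v \<subseteq> carrier U"
  by (auto simp: Aut_carrier)

lemma Aut_lists: "\<sigma> \<in> Aut \<Longrightarrow> map \<sigma> c \<in> lists (carrier U) \<longleftrightarrow> c \<in> lists (carrier U)"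
  by (auto simp: Aut_carrier in_lists_conv_set)

lemma Aut_map_fixes: "\<sigma> \<in> Aut \<Longrightarrow> c \<in> lists (carrier M) \<Longrightarrow> map \<sigma> c = c"
  by (auto simp: Aut_fixes in_lists_conv_set intro: map_idI)

lemma Aut_bij:
  assumes "\<sigma> \<in> Aut"
  shows "bij \<sigma>"
proof -
  have "bij_betw \<sigma> (carrier U) (carrier U)" using assms by (simp add: Aut_def automorphism_def)
  moreover have "bij_betw \<sigma> (- carrier U) (- carrier U)"
    using assms by (auto simp: Aut_def bij_betw_def inj_on_def image_iff)
  ultimately have "bij_betw \<sigma> (carrier U \<union> - carrier U) (carrier U \<union> - carrier U)"
    by (rule bij_betw_combine) simp
  then show ?thesis by simp
qed

lemma fun_of_carrier:
  "(f, length xs) \<in> funs L \<Longrightarrow> xs \<in> lists (carrier U) \<Longrightarrow> fun_of U f xs \<in> carrier U"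
  using structure_U unfolding structure_for_def by blast

lemma Aut_fun_of:
  "\<sigma> \<in> Aut \<Longrightarrow> (f, length xs) \<in> funs L \<Longrightarrow> xs \<in> lists (carrier U) \<Longrightarrow>
   \<sigma> (fun_of U f xs) = fun_of U f (map \<sigma> xs)"
  unfolding Aut_def automorphism_def by blast

lemma Aut_rel_of:
  "\<sigma> \<in> Aut \<Longrightarrow> (r, length xs) \<in> rels L \<Longrightarrow> xs \<in> lists (carrier U) \<Longrightarrow>
   rel_of U r xs \<longleftrightarrow> rel_of U r (map \<sigma> xs)"
  unfolding Aut_def automorphism_def by blast

lemma id_Aut: "id \<in> Aut"
  by (auto simp: Aut_def automorphism_def)

lemma comp_Aut:
  assumes "\<sigma> \<in> Aut" "\<tau> \<in> Aut"
  shows "\<sigma> \<circ> \<tau> \<in> Aut"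
proof -
  have "bij_betw (\<sigma> \<circ> \<tau>) (carrier U) (carrier U)"
    using assms by (auto simp: Aut_def automorphism_def intro: bij_betw_trans)
  moreover have "(\<sigma> \<circ> \<tau>) (fun_of U f xs) = fun_of U f (map (\<sigma> \<circ> \<tau>) xs)"
    if "(f, length xs) \<in> funs L" "xs \<in> lists (carrier U)" for f xs
    using that assms Aut_fun_of[of \<tau> f xs] Aut_fun_of[of \<sigma> f "map \<tau> xs"] Aut_lists[of \<tau> xs] by simp
  moreover have "rel_of U r xs \<longleftrightarrow> rel_of U r (map (\<sigma> \<circ> \<tau>) xs)"
    if "(r, length xs) \<in> rels L" "xs \<in> lists (carrier U)" for r xs
    using that assms Aut_rel_of[of \<tau> r xs] Aut_rel_of[of \<sigma> r "map \<tau> xs"] Aut_lists[of \<tau> xs] by simp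
  moreover have "\<forall>x\<in>carrier M. (\<sigma> \<circ> \<tau>) x = x" "\<forall>x. x \<notin> carrier U \<longrightarrow> (\<sigma> \<circ> \<tau>) x = x"
    using assms by (auto simp: Aut_def)
  ultimately show ?thesis unfolding Aut_def automorphism_def by blast
qed

lemma inv_Aut:
  assumes "\<sigma> \<in> Aut"
  shows "inv \<sigma> \<in> Aut"
proof -
  have inv1: "inv \<sigma> (\<sigma> x) = x" and inv2: "\<sigma> (inv \<sigma> x) = x" for x
    using Aut_bij[OF assms] by (auto simp: bij_def surj_f_inv_f)
  have car: "inv \<sigma> x \<in> carrier U \<longleftrightarrow> x \<in> carrier U" for x
    using Aut_carrier[OF assms, of "inv \<sigma> x"] by (simp add: inv2)
  have maps: "map \<sigma> (map (inv \<sigma>) xs) = xs" for xs by (simp add: inv2 comp_def)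
  have lists: "map (inv \<sigma>) xs \<in> lists (carrier U)" if "xs \<in> lists (carrier U)" for xs
    using that by (auto simp: in_lists_conv_set car)
  have "bij_betw (inv \<sigma>) (carrier U) (carrier U)"
    by (rule bij_betw_byWitness[where f' = \<sigma>]) (auto simp: inv1 inv2 car Aut_carrier[OF assms])
  moreover have "inv \<sigma> (fun_of U f xs) = fun_of U f (map (inv \<sigma>) xs)"
    if "(f, length xs) \<in> funs L" "xs \<in> lists (carrier U)" for f xs
    using Aut_fun_of[OF assms, of f "map (inv \<sigma>) xs"] that lists maps[of xs] inv1
    by (metis length_map)
  moreover have "rel_of U r xs \<longleftrightarrow> rel_of U r (map (inv \<sigma>) xs)"
    if "(r, length xs) \<in> rels L" "xs \<in> lists (carrier U)" for r xs
    using Aut_rel_of[OF assms, of r "map (inv \<sigma>) xs"] that lists maps[of xs] by simp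
  moreover have "\<forall>x\<in>carrier M. inv \<sigma> x = x" "\<forall>x. x \<notin> carrier U \<longrightarrow> inv \<sigma> x = x"
    using assms inv1 by (auto simp: Aut_def) (metis inv1)+
  ultimately show ?thesis unfolding Aut_def automorphism_def by blast
qed

lemma Aut_tm_val:
  assumes "\<sigma> \<in> Aut"
  shows "wf_tm L t \<Longrightarrow> (\<And>i. i \<in> tm_vars t \<Longrightarrow> e i \<in> carrier U) \<Longrightarrow>
    tm_val U e t \<in> carrier U \<and> tm_val U (\<sigma> \<circ> e) t = \<sigma> (tm_val U e t)"
proof (induction t)
  case (Fn f ts)
  have IH: "tm_val U e t \<in> carrier U \<and> tm_val U (\<sigma> \<circ> e) t = \<sigma> (tm_val U e t)" if "t \<in> set ts" for t
    by (rule Fn.IH[OF that]) (use Fn.prems that in \<open>auto simp: list_all_iff\<close>)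
  then have "map (tm_val U e) ts \<in> lists (carrier U)" by auto
  moreover have "(f, length (map (tm_val U e) ts)) \<in> funs L" using Fn.prems by simp
  moreover have "map (tm_val U (\<sigma> \<circ> e)) ts = map \<sigma> (map (tm_val U e) ts)" using IH by simp
  ultimately show ?case
    using fun_of_carrier Aut_fun_of[OF assms] by (metis tm_val.simps(2))
qed simp

lemma Aut_sat:
  assumes "\<sigma> \<in> Aut"
  shows "wf_fm L \<phi> \<Longrightarrow> (\<And>i. i \<in> fv \<phi> \<Longrightarrow> e i \<in> carrier U) \<Longrightarrow> sat U (\<sigma> \<circ> e) \<phi> \<longleftrightarrow> sat U e \<phi>"
proof (induction \<phi> arbitrary: e)
  case (Eq s t)
  have "tm_val U (\<sigma> \<circ> e) s = \<sigma> (tm_val U e s)" "tm_val U (\<sigma> \<circ> e) t = \<sigma> (tm_val U e t)"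
    using Aut_tm_val[OF assms] Eq by auto
  then show ?case using Aut_bij[OF assms] by (simp only: sat.simps bij_def inj_eq)
next
  case (Rl r ts)
  have "tm_val U e t \<in> carrier U \<and> tm_val U (\<sigma> \<circ> e) t = \<sigma> (tm_val U e t)" if "t \<in> set ts" for t
    using Aut_tm_val[OF assms, of t e] Rl that by (auto simp: list_all_iff)
  then have "map (tm_val U e) ts \<in> lists (carrier U)"
    and "map (tm_val U (\<sigma> \<circ> e)) ts = map \<sigma> (map (tm_val U e) ts)" by auto
  moreover have "(r, length (map (tm_val U e) ts)) \<in> rels L" using Rl.prems(1) by simp
  ultimately show ?case using Aut_rel_of[OF assms] by (simp only: sat.simps)
next
  case (All \<phi>)
  have ext: "case_nat (\<sigma> z) (\<sigma> \<circ> e) = \<sigma> \<circ> case_nat z e" for z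
    by (auto simp: fun_eq_iff split: nat.split)
  have "sat U (case_nat (\<sigma> z) (\<sigma> \<circ> e)) \<phi> \<longleftrightarrow> sat U (case_nat z e) \<phi>" if "z \<in> carrier U" for z
    unfolding ext by (rule All.IH) (use All.prems that in \<open>auto split: nat.split\<close>)
  moreover have "carrier U = \<sigma> ` carrier U"
    using assms by (auto simp: Aut_def automorphism_def bij_betw_def)
  ultimately show ?case by (metis (no_types, lifting) image_iff sat.simps(5))
next
  case (Imp \<phi> \<psi>)
  have "sat U (\<sigma> \<circ> e) \<phi> \<longleftrightarrow> sat U e \<phi>" "sat U (\<sigma> \<circ> e) \<psi> \<longleftrightarrow> sat U e \<psi>"
    by (rule Imp.IH; use Imp.prems in simp)+
  then show ?case by (simp only: sat.simps)
qed simp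

lemma Aut_sat_map:
  assumes "\<sigma> \<in> Aut" "\<phi> \<in> formulas L" "l \<in> lists (carrier U)" "fv \<phi> \<subseteq> {..<length l}"
  shows "sat U ((!) (map \<sigma> l)) \<phi> \<longleftrightarrow> sat U ((!) l) \<phi>"
proof -
  have "sat U ((!) (map \<sigma> l)) \<phi> \<longleftrightarrow> sat U (\<sigma> \<circ> (!) l) \<phi>"
    by (rule sat_cong) (use assms(4) in auto)
  also have "\<dots> \<longleftrightarrow> sat U ((!) l) \<phi>"
    by (rule Aut_sat[OF assms(1)])
      (use assms(2-4) in \<open>auto simp: formulas_def in_lists_conv_set subset_iff\<close>)
  finally show ?thesis .
qed

lemma Aut_definable:
  assumes "\<sigma> \<in> Aut" "definable L U I (carrier M) R" "range a \<subseteq> carrier U"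
  shows "R (\<sigma> \<circ> a) \<longleftrightarrow> R a"
proof -
  obtain \<phi> xs c where \<chi>: "(\<phi>, xs, c) \<in> pformulas L I (carrier M)" "distinct xs"
    and R: "\<And>a. range a \<subseteq> carrier U \<Longrightarrow> R a \<longleftrightarrow> psat U a (\<phi>, xs, c)"
    by (rule definable_imp_pformula[OF assms(2)]) (rule that)
  have c: "c \<in> lists (carrier M)" "\<phi> \<in> formulas L" "fv \<phi> \<subseteq> {..<length (map a xs @ c)}"
    using \<chi> by (auto simp: pformulas_def)
  have l: "map a xs @ c \<in> lists (carrier U)"
    using c(1) submodel_subset assms(3) by (auto simp: in_lists_conv_set)
  have eq: "map (\<sigma> \<circ> a) xs @ c = map \<sigma> (map a xs @ c)"
    using Aut_map_fixes[OF assms(1) c(1)] by simp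
  have "psat U (\<sigma> \<circ> a) (\<phi>, xs, c) \<longleftrightarrow> psat U a (\<phi>, xs, c)"
    unfolding psat.simps eq by (rule Aut_sat_map[OF assms(1) c(2) l c(3)])
  then show ?thesis
    using R[OF assms(3)] R[of "\<sigma> \<circ> a"] Aut_range[OF assms(1), of a] assms(3) by (simp only:)
qed

lemma equiv_over_Aut:
  assumes "\<sigma> \<in> Aut" "c \<in> lists (carrier U)"
  shows "equiv_over L U (carrier M) c (map \<sigma> c)"
proof -
  have "psat U ((!) (map \<sigma> c)) \<chi> \<longleftrightarrow> psat U ((!) c) \<chi>"
    if "\<chi> \<in> pformulas L {..<length c} (carrier M)" for \<chi>
  proof -
    obtain \<phi> xs m where \<chi>: "\<chi> = (\<phi>, xs, m)" by (cases \<chi>)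
    have m: "m \<in> lists (carrier M)" and xs: "set xs \<subseteq> {..<length c}" and \<phi>: "\<phi> \<in> formulas L"
      "fv \<phi> \<subseteq> {..<length (map ((!) c) xs @ m)}"
      using that by (auto simp: \<chi> pformulas_def)
    have l: "map ((!) c) xs @ m \<in> lists (carrier U)"
      using m submodel_subset xs assms(2) by (auto simp: in_lists_conv_set)
    have "map ((!) (map \<sigma> c)) xs @ m = map \<sigma> (map ((!) c) xs @ m)"
      using Aut_map_fixes[OF assms(1) m] xs by auto
    then show ?thesis
      using Aut_sat_map[OF assms(1) \<phi>(1) l \<phi>(2)] by (simp only: \<chi> psat.simps)
  qed
  then show ?thesis by (auto simp: equiv_over_def tp_list_def tp_def simp del: psat.simps)
qed

text \<open>Homogeneity relative to \<open>M\<close>: the map that fixes \<open>M\<close> and sends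
  \<open>a\<close> to \<open>b\<close> entrywise is elementary, and its domain is small since
  \<open>a\<close> is finite.\<close>

lemma Aut_exists:
  assumes len: "length a = length b" and a: "a \<in> lists (carrier U)" and b: "b \<in> lists (carrier U)"
    and eq: "\<And>\<phi> m. \<phi> \<in> formulas L \<Longrightarrow> m \<in> lists (carrier M) \<Longrightarrow>
      fv \<phi> \<subseteq> {..<length a + length m} \<Longrightarrow> sat U ((!) (a @ m)) \<phi> \<longleftrightarrow> sat U ((!) (b @ m)) \<phi>"
  obtains \<sigma> where "\<sigma> \<in> Aut" "map \<sigma> a = b"
proof -
  \<comment> \<open>Two kinds of equations in the type make the map well defined: an entry of
    \<open>a\<close> lying in \<open>M\<close> equals the same element in \<open>b\<close>, and
    repeated entries of \<open>a\<close> are repeated in \<open>b\<close>.\<close>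
  have inM: "b ! i = a ! i" if "i < length a" "a ! i \<in> carrier M" for i
    using eq[of "Eq (Var i) (Var (length a))" "[a ! i]"] that len
    by (auto simp: formulas_def nth_append)
  have wd: "b ! i = b ! j" if "i < length a" "j < length a" "a ! i = a ! j" for i j
    using eq[of "Eq (Var i) (Var j)" "[]"] that len by (auto simp: formulas_def)
  define g where "g x = (if x \<in> carrier M then x else b ! (SOME i. i < length a \<and> a ! i = x))" for x
  have ga: "g (a ! i) = b ! i" if "i < length a" for i
  proof (cases "a ! i \<in> carrier M")
    case False
    have "(SOME j. j < length a \<and> a ! j = a ! i) < length a \<and> a ! (SOME j. j < length a \<and> a ! j = a ! i) = a ! i"
      using that by (intro someI[of "\<lambda>j. j < length a \<and> a ! j = a ! i" i]) simp
    then have "b ! (SOME j. j < length a \<and> a ! j = a ! i) = b ! i" using wd[OF _ that] by blast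
    then show ?thesis using False by (simp add: g_def)
  qed (use inM that in \<open>simp add: g_def\<close>)
  have gM: "g x = x" if "x \<in> carrier M" for x using that by (simp add: g_def)
  let ?A = "carrier M \<union> set a"
  have sat: "sat U ((!) d) \<phi> \<longleftrightarrow> sat U ((!) (map g d)) \<phi>"
    if d: "d \<in> lists ?A" and \<phi>: "\<phi> \<in> formulas L" "fv \<phi> \<subseteq> {..<length d}" for d \<phi>
  proof -
    \<comment> \<open>Each element of the domain has a name, a position in \<open>a\<close> or an
      element of \<open>M\<close>, from which both it and its image are computed. A formula about
      \<open>d\<close> thus becomes a formula about \<open>a\<close> with parameters
      \<open>m\<close> in \<open>M\<close>.\<close>
    have "\<forall>x. x \<in> ?A \<longrightarrow> (\<exists>u. u \<in> {..<length a} <+> carrier M \<and> x = case_sum ((!) a) id u \<and> g x = case_sum ((!) b) id u)"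
    proof (intro allI impI)
      fix x assume x: "x \<in> ?A"
      show "\<exists>u. u \<in> {..<length a} <+> carrier M \<and> x = case_sum ((!) a) id u \<and> g x = case_sum ((!) b) id u"
      proof (cases "x \<in> carrier M")
      case True
      then show ?thesis using gM by (intro exI[of _ "Inr x"]) auto
    next
      case False
      then obtain i where "i < length a" "x = a ! i" using x by (auto simp: in_set_conv_nth)
      then show ?thesis using ga by (intro exI[of _ "Inl i"]) auto
      qed
    qed
    then obtain f where f: "\<And>x. x \<in> ?A \<Longrightarrow> f x \<in> {..<length a} <+> carrier M"
      "\<And>x. x \<in> ?A \<Longrightarrow> x = case_sum ((!) a) id (f x)" "\<And>x. x \<in> ?A \<Longrightarrow> g x = case_sum ((!) b) id (f x)"
      unfolding choice_iff' by blast
    define u where "u = map f d"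
    have u: "u \<in> lists ({..<length a} <+> carrier M)"
      using f(1) d by (auto simp: u_def in_lists_conv_set)
    have du: "d = map (case_sum ((!) a) id) u" "map g d = map (case_sum ((!) b) id) u"
      using f(2,3) d by (simp_all add: u_def in_lists_conv_set map_idI)
    obtain xs m where m: "xs \<in> lists {..<length a}" "m \<in> lists (carrier M)"
      "set u = Inl ` set xs \<union> Inr ` set m" "distinct xs"
      by (rule sum_list_partition[OF u]) (rule that)
    let ?u = "map Inl [0..<length a] @ map Inr m"
    have "fv \<phi> \<subseteq> {..<length u}" using \<phi>(2) by (simp add: u_def)
    moreover have "set u \<subseteq> set ?u" using m(1,3) by (auto simp: in_lists_conv_set)
    ultimately obtain \<psi> where \<psi>: "\<psi> \<in> formulas L" "fv \<psi> \<subseteq> {..<length ?u}"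
      "\<And>h. sat U ((!) (map h ?u)) \<psi> \<longleftrightarrow> sat U ((!) (map h u)) \<phi>"
      by (rule reindex_formula[OF \<phi>(1)]) (rule that)
    have "map (case_sum ((!) a) id) ?u = a @ m" by (simp add: comp_def map_nth)
    moreover have "map (case_sum ((!) b) id) ?u = b @ m" by (simp add: comp_def map_nth len)
    moreover have "sat U ((!) (a @ m)) \<psi> \<longleftrightarrow> sat U ((!) (b @ m)) \<psi>"
      by (rule eq) (use \<psi>(1,2) m(2) in auto)
    ultimately show ?thesis
      using \<psi>(3)[of "case_sum ((!) a) id"] \<psi>(3)[of "case_sum ((!) b) id"] du by (simp only:)
  qed
  have "equiv_over L U {} c (map g c)" if c: "c \<in> lists ?A" for c
  proof -
    have "psat U ((!) (map g c)) \<chi> \<longleftrightarrow> psat U ((!) c) \<chi>"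
      if mem: "\<chi> \<in> pformulas L {..<length c} {}" for \<chi>
    proof -
      obtain \<phi> xs m where \<chi>: "\<chi> = (\<phi>, xs, m)" by (cases \<chi>)
      have m: "m = []" and xs: "set xs \<subseteq> {..<length c}" and \<phi>: "\<phi> \<in> formulas L"
        "fv \<phi> \<subseteq> {..<length (map ((!) c) xs)}"
        using mem by (auto simp: \<chi> pformulas_def)
      have "c ! i \<in> ?A" if "i < length c" for i using c nth_mem[OF that] unfolding in_lists_conv_set by blast
      then have "map ((!) c) xs \<in> lists ?A" using xs by (auto simp: in_lists_conv_set subset_iff)
      moreover have "map ((!) (map g c)) xs = map g (map ((!) c) xs)" using xs by auto
      ultimately show ?thesis using sat[OF _ \<phi>] by (simp only: \<chi> m psat.simps append_Nil2)
    qed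
    then show ?thesis by (auto simp: equiv_over_def tp_list_def tp_def simp del: psat.simps)
  qed
  moreover have "g ` ?A \<subseteq> carrier U"
  proof -
    have "g x \<in> carrier U" if "x \<in> set a" for x
    proof -
      obtain i where "i < length a" "x = a ! i" using \<open>x \<in> set a\<close> by (metis in_set_conv_nth)
      then show ?thesis using ga b len by (auto simp: in_lists_conv_set)
    qed
    then show ?thesis using gM submodel_subset by auto
  qed
  moreover have "?A \<subseteq> carrier U" using a submodel_subset by (auto simp: in_lists_conv_set)
  moreover have "|?A| <o \<kappa>" by (rule small_parameters) simp
  ultimately obtain \<sigma> where \<sigma>: "automorphism L U \<sigma>" "\<forall>x\<in>?A. \<sigma> x = g x"
    using homogeneous[unfolded strongly_homogeneous_def, rule_format, of ?A g] by blast
  \<comment> \<open>Homogeneity controls the map on the carrier only; elsewhere it is reset to the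
    identity, as \<open>Aut\<close> demands.\<close>
  define \<sigma>' where "\<sigma>' x = (if x \<in> carrier U then \<sigma> x else x)" for x
  have map': "map \<sigma>' xs = map \<sigma> xs" if "xs \<in> lists (carrier U)" for xs
    using that by (auto simp: \<sigma>'_def in_lists_conv_set)
  have "bij_betw \<sigma>' (carrier U) (carrier U)"
    using \<sigma>(1) by (auto simp: automorphism_def \<sigma>'_def cong: bij_betw_cong)
  moreover have "\<sigma>' (fun_of U f xs) = fun_of U f (map \<sigma>' xs)"
    if "(f, length xs) \<in> funs L" "xs \<in> lists (carrier U)" for f xs
  proof -
    have "\<sigma> (fun_of U f xs) = fun_of U f (map \<sigma> xs)"
      using \<sigma>(1) that unfolding automorphism_def by blast
    then show ?thesis unfolding map'[OF that(2)] using fun_of_carrier[OF that] by (simp add: \<sigma>'_def)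
  qed
  moreover have "rel_of U r xs \<longleftrightarrow> rel_of U r (map \<sigma>' xs)"
    if "(r, length xs) \<in> rels L" "xs \<in> lists (carrier U)" for r xs
    using \<sigma>(1) that unfolding automorphism_def map'[OF that(2)] by blast
  ultimately have "automorphism L U \<sigma>'" unfolding automorphism_def by blast
  moreover have "\<forall>x\<in>carrier M. \<sigma>' x = x" using \<sigma>(2) gM submodel_subset by (auto simp: \<sigma>'_def)
  ultimately have "\<sigma>' \<in> Aut" by (simp add: Aut_def \<sigma>'_def)
  moreover have "map \<sigma>' a = b"
    using map'[OF a] \<sigma>(2) ga len by (auto intro!: nth_equalityI)
  ultimately show thesis by (rule that)
qed

section \<open>Solution sets and the action of the automorphisms on them\<close>

definition solutions :: "('a, 'f, 'r, 'a) pfm \<Rightarrow> ('a \<Rightarrow> 'a) set" where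
  "solutions \<chi> = {v. range v \<subseteq> carrier U \<and> psat U v \<chi>}"

text \<open>The group acts on assignments by composition from the left. Variables are named by
  elements of the model because \<open>tp_set\<close> enumerates a set by itself.\<close>

definition Aut_action :: "(('a \<Rightarrow> 'a) \<Rightarrow> 'a \<Rightarrow> 'a) set" where
  "Aut_action = (\<lambda>\<sigma> v. \<sigma> \<circ> v) ` Aut"

sublocale permutation_group Aut_action
proof
  show "id \<in> Aut_action"
    unfolding Aut_action_def by (rule image_eqI[OF _ id_Aut]) auto
  show "g \<circ> h \<in> Aut_action" if "g \<in> Aut_action" "h \<in> Aut_action" for g h
  proof -
    obtain \<sigma> \<tau> where "\<sigma> \<in> Aut" "\<tau> \<in> Aut" "g = (\<lambda>v. \<sigma> \<circ> v)" "h = (\<lambda>v. \<tau> \<circ> v)"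
      using \<open>g \<in> _\<close> \<open>h \<in> _\<close> unfolding Aut_action_def by blast
    then show ?thesis
      unfolding Aut_action_def by (intro image_eqI[OF _ comp_Aut[of \<sigma> \<tau>]]) (auto simp: fun_eq_iff)
  qed
  show "\<exists>h\<in>Aut_action. g \<circ> h = id \<and> h \<circ> g = id" if "g \<in> Aut_action" for g
  proof -
    obtain \<sigma> where \<sigma>: "\<sigma> \<in> Aut" "g = (\<lambda>v. \<sigma> \<circ> v)"
      using \<open>g \<in> _\<close> unfolding Aut_action_def by blast
    have "inv \<sigma> (\<sigma> x) = x" "\<sigma> (inv \<sigma> x) = x" for x
      using Aut_bij[OF \<sigma>(1)] by (auto simp: bij_def surj_f_inv_f)
    then show ?thesis
      unfolding Aut_action_def
      by (intro bexI[OF _ imageI[OF inv_Aut[OF \<sigma>(1)]]]) (simp add: \<sigma>(2) fun_eq_iff)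
  qed
qed

text \<open>Automorphisms preserve truth, so translating a solution set amounts to conjugating the
  parameters; since translates are preimages, the parameters move backwards.\<close>

lemma vimage_solutions:
  assumes "\<sigma> \<in> Aut" "(\<phi>, xs, c) \<in> pformulas L UNIV (carrier U)"
  shows "(\<lambda>v. \<sigma> \<circ> v) -` solutions (\<phi>, xs, map \<sigma> c) = solutions (\<phi>, xs, c)"
proof -
  have "psat U (\<sigma> \<circ> v) (\<phi>, xs, map \<sigma> c) \<longleftrightarrow> psat U v (\<phi>, xs, c)" if "range v \<subseteq> carrier U" for v
  proof -
    have "map (\<sigma> \<circ> v) xs @ map \<sigma> c = map \<sigma> (map v xs @ c)" by simp
    moreover have "map v xs @ c \<in> lists (carrier U)"
      using that assms(2) by (auto simp: pformulas_def in_lists_conv_set)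
    ultimately show ?thesis
      using Aut_sat_map[OF assms(1), of \<phi> "map v xs @ c"] assms(2)
      by (simp add: pformulas_def del: map_append map_map)
  qed
  then show ?thesis
    unfolding solutions_def vimage_Collect_eq Aut_range[OF assms(1)] by (simp only: cong: conj_cong)
qed

subsection \<open>Kim-dividing formulas\<close>

lemma global_type_neg:
  assumes "global_type L U J q" "(\<phi>, xs, c) \<in> pformulas L J (carrier U)"
  shows "(Neg \<phi>, xs, c) \<in> q \<longleftrightarrow> (\<phi>, xs, c) \<notin> q"
proof
  assume neg: "(Neg \<phi>, xs, c) \<in> q"
  show "(\<phi>, xs, c) \<notin> q"
  proof
    assume "(\<phi>, xs, c) \<in> q"
    with neg have "{(\<phi>, xs, c), (Neg \<phi>, xs, c)} \<subseteq> q" by simp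
    moreover have "consistent U q"
      using assms(1) by (simp add: global_type_def complete_type_over_def type_over_def)
    ultimately obtain a where "realizes U a {(\<phi>, xs, c), (Neg \<phi>, xs, c)}"
      unfolding consistent_def by (meson finite.emptyI finite.insertI)
    then show False by (simp add: realizes_def)
  qed
next
  assume "(\<phi>, xs, c) \<notin> q"
  then show "(Neg \<phi>, xs, c) \<in> q"
    using assms unfolding global_type_def complete_type_over_def by blast
qed

lemma invariant_type_Aut:
  assumes "invariant_type L U J (carrier M) q" "(\<phi>, xs, c) \<in> pformulas L J (carrier U)" "\<sigma> \<in> Aut"
  shows "(\<phi>, xs, map \<sigma> c) \<in> q \<longleftrightarrow> (\<phi>, xs, c) \<in> q"
proof -
  have c: "c \<in> lists (carrier U)" using assms(2) by (simp add: pformulas_def)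
  then have "map \<sigma> c \<in> lists (carrier U)" using Aut_lists[OF assms(3)] by simp
  then show ?thesis
    using assms(1,2) equiv_over_Aut[OF assms(3) c] unfolding invariant_type_def by blast
qed

text \<open>Fixing the variable list \<open>[0..<length a]\<close> turns substitution into the
  concatenation \<open>a @ c\<close>. Nothing is lost for complete types, as reindexing brings every
  formula to this form.\<close>

definition realizes_over :: "('a, 'f, 'r, nat) pfm set \<Rightarrow> 'a set \<Rightarrow> 'a list \<Rightarrow> bool" where
  "realizes_over q A a \<longleftrightarrow> a \<in> lists (carrier U) \<and>
     (\<forall>\<phi> c. (\<phi>, [0..<length a], c) \<in> q \<and> c \<in> lists A \<longrightarrow> sat U ((!) (a @ c)) \<phi>)"

text \<open>Finite Morley sequences are lists whose head is the last element of the sequence.\<close>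

primrec Morley_list :: "('a, 'f, 'r, nat) pfm set \<Rightarrow> nat \<Rightarrow> 'a set \<Rightarrow> 'a list list \<Rightarrow> bool" where
  "Morley_list q n A [] \<longleftrightarrow> True"
| "Morley_list q n A (a # as) \<longleftrightarrow>
     length a = n \<and> realizes_over q (A \<union> set (concat as)) a \<and> Morley_list q n A as"

section \<open>Finite Morley sequences: existence and uniqueness up to conjugation\<close>

lemma realizes_over_mono: "realizes_over q A a \<Longrightarrow> B \<subseteq> A \<Longrightarrow> realizes_over q B a"
  unfolding realizes_over_def using lists_mono by blast

lemma Morley_list_mono: "Morley_list q n A as \<Longrightarrow> B \<subseteq> A \<Longrightarrow> Morley_list q n B as"
proof (induction as)
  case (Cons a as)
  have "B \<union> set (concat as) \<subseteq> A \<union> set (concat as)" using Cons.prems(2) by blast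
  then show ?case using Cons realizes_over_mono by auto
qed simp

text \<open>Since \<open>cs\<close> was built over all entries of \<open>bs\<close>, it continues
  that sequence; later elements stand in front, whence the order \<open>cs @ bs\<close>.\<close>

lemma Morley_list_append:
  "Morley_list q n (A \<union> Z) cs \<Longrightarrow> Morley_list q n A bs \<Longrightarrow> set (concat bs) \<subseteq> Z \<Longrightarrow>
   Morley_list q n A (cs @ bs)"
proof (induction cs)
  case (Cons c cs)
  have "A \<union> set (concat (cs @ bs)) \<subseteq> A \<union> Z \<union> set (concat cs)" using Cons.prems(3) by auto
  then show ?case using Cons realizes_over_mono by auto
qed simp

lemma Morley_list_lists: "Morley_list q n A as \<Longrightarrow> concat as \<in> lists (carrier U)"
  by (induction as) (auto simp: realizes_over_def in_lists_conv_set)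

lemma Morley_list_length: "Morley_list q n A as \<Longrightarrow> a \<in> set as \<Longrightarrow> length a = n"
  by (induction as) auto

text \<open>Either \<phi> or its negation belongs to the complete type \<open>q\<close>, and
  whichever does is true of \<open>a\<close>.\<close>

lemma sat_iff_mem:
  assumes q: "global_type L U {..<n} q" and a: "realizes_over q A a" "length a = n" and "A \<subseteq> carrier U"
    and "\<phi> \<in> formulas L" "c \<in> lists A" "fv \<phi> \<subseteq> {..<length a + length c}"
  shows "sat U ((!) (a @ c)) \<phi> \<longleftrightarrow> (\<phi>, [0..<n], c) \<in> q"
proof -
  have "c \<in> lists (carrier U)" using assms(4,6) by auto
  then have "(\<phi>, [0..<n], c) \<in> pformulas L {..<n} (carrier U)"
    using assms a(2) by (auto simp: pformulas_def)
  from global_type_neg[OF q this] have "(Neg \<phi>, [0..<n], c) \<in> q \<longleftrightarrow> (\<phi>, [0..<n], c) \<notin> q" .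
  moreover have "(\<psi>, [0..<n], c) \<in> q \<Longrightarrow> sat U ((!) (a @ c)) \<psi>" for \<psi>
    using a assms(6) unfolding realizes_over_def by blast
  ultimately show ?thesis by (metis sat.simps(1,4))
qed

lemma Morley_list_Aut:
  assumes q: "invariant_type L U {..<n} (carrier M) q" and "\<sigma> \<in> Aut"
  shows "Morley_list q n (carrier M) as \<Longrightarrow> Morley_list q n (carrier M) (map (map \<sigma>) as)"
proof (induction as)
  case (Cons a as)
  let ?A = "carrier M \<union> set (concat as)"
  have gl: "global_type L U {..<n} q" using q by (simp add: invariant_type_def)
  have a: "realizes_over q ?A a" "length a = n" and as: "Morley_list q n (carrier M) as"
    using Cons.prems by auto
  have aU: "a \<in> lists (carrier U)" using a(1) by (simp add: realizes_over_def)
  have A: "?A \<subseteq> carrier U" using Morley_list_lists[OF as] submodel_subset by (auto simp: in_lists_conv_set)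
  have "realizes_over q (carrier M \<union> set (concat (map (map \<sigma>) as))) (map \<sigma> a)"
    unfolding realizes_over_def
  proof (intro conjI allI impI)
    show "map \<sigma> a \<in> lists (carrier U)" using aU Aut_lists[OF assms(2)] by simp
    fix \<phi> c assume c: "(\<phi>, [0..<length (map \<sigma> a)], c) \<in> q \<and> c \<in> lists (carrier M \<union> set (concat (map (map \<sigma>) as)))"
    have "\<sigma> ` carrier M = carrier M" using Aut_fixes[OF assms(2)] by simp
    moreover have "set (concat (map (map \<sigma>) as)) = \<sigma> ` set (concat as)"
      unfolding map_concat[symmetric] by (rule set_map)
    ultimately have "carrier M \<union> set (concat (map (map \<sigma>) as)) = \<sigma> ` ?A"
      by (simp only: image_Un)
    with c have "c \<in> map \<sigma> ` lists ?A" by (simp add: lists_image)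
    then obtain d where d: "d \<in> lists ?A" "c = map \<sigma> d" by blast
    have dU: "d \<in> lists (carrier U)" using d(1) A by auto
    have "q \<subseteq> pformulas L {..<n} (carrier U)"
      using gl by (simp add: global_type_def complete_type_over_def type_over_def)
    then have "(\<phi>, [0..<n], c) \<in> pformulas L {..<n} (carrier U)" using c a(2) by auto
    then have \<phi>: "\<phi> \<in> formulas L" "fv \<phi> \<subseteq> {..<length (a @ d)}"
      and pf: "(\<phi>, [0..<n], d) \<in> pformulas L {..<n} (carrier U)"
      using dU a(2) by (auto simp: pformulas_def d(2))
    from invariant_type_Aut[OF q pf assms(2)] have "(\<phi>, [0..<n], d) \<in> q" using c a(2) d(2) by simp
    then have "sat U ((!) (a @ d)) \<phi>" using a d(1) by (simp add: realizes_over_def)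
    then show "sat U ((!) (map \<sigma> a @ c)) \<phi>"
      using Aut_sat_map[OF assms(2) \<phi>(1) _ \<phi>(2)] aU dU d(2) by simp
  qed
  then show ?case using Cons a(2) by simp
qed simp

text \<open>If \<sigma> matches the tails, invariance of \<open>q\<close> under \<sigma> shows that
  \<open>a\<close> over the first tail and \<open>b\<close> over the second satisfy corresponding
  formulas. The whole tuples therefore have the same type over \<open>M\<close>, and homogeneity
  gives an automorphism moving one to the other.\<close>

lemma Morley_list_unique:
  assumes q: "invariant_type L U {..<n} (carrier M) q"
  shows "Morley_list q n (carrier M) as \<Longrightarrow> Morley_list q n (carrier M) bs \<Longrightarrow> length as = length bs \<Longrightarrow>
    \<exists>\<sigma>\<in>Aut. map (map \<sigma>) as = bs"
proof (induction as arbitrary: bs)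
  case Nil
  then show ?case using id_Aut by auto
next
  case (Cons a as)
  obtain b bs' where bs: "bs = b # bs'" using Cons.prems(3) by (cases bs) auto
  have gl: "global_type L U {..<n} q" using q by (simp add: invariant_type_def)
  have a: "realizes_over q (carrier M \<union> set (concat as)) a" "length a = n" "Morley_list q n (carrier M) as"
    using Cons.prems(1) by auto
  have b: "realizes_over q (carrier M \<union> set (concat bs')) b" "length b = n" "Morley_list q n (carrier M) bs'"
    using Cons.prems(2) bs by auto
  obtain \<sigma> where \<sigma>: "\<sigma> \<in> Aut" "map (map \<sigma>) as = bs'"
    using Cons.IH[OF a(3) b(3)] Cons.prems(3) bs by auto
  have conc: "concat bs' = map \<sigma> (concat as)" using \<sigma>(2) by (auto simp: map_concat)
  have U: "concat as \<in> lists (carrier U)" "concat bs' \<in> lists (carrier U)"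
    "a \<in> lists (carrier U)" "b \<in> lists (carrier U)"
    using Morley_list_lists[OF a(3)] Morley_list_lists[OF b(3)] a(1) b(1) by (auto simp: realizes_over_def)
  have sub: "carrier M \<union> set (concat as) \<subseteq> carrier U" "carrier M \<union> set (concat bs') \<subseteq> carrier U"
    using U(1,2) submodel_subset unfolding in_lists_conv_set by blast+
  have eq: "sat U ((!) ((a @ concat as) @ m)) \<phi> \<longleftrightarrow> sat U ((!) ((b @ concat bs') @ m)) \<phi>"
    if \<phi>: "\<phi> \<in> formulas L" and m: "m \<in> lists (carrier M)" and fv: "fv \<phi> \<subseteq> {..<length (a @ concat as) + length m}"
    for \<phi> m
  proof -
    have lists: "concat as @ m \<in> lists (carrier M \<union> set (concat as))"
      "concat bs' @ m \<in> lists (carrier M \<union> set (concat bs'))"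
      using m by (auto simp: in_lists_conv_set)
    have len: "length (concat bs' @ m) = length (concat as @ m)" using conc by simp
    have "sat U ((!) (a @ concat as @ m)) \<phi> \<longleftrightarrow> (\<phi>, [0..<n], concat as @ m) \<in> q"
      by (rule sat_iff_mem[OF gl a(1,2) sub(1) \<phi> lists(1)]) (use fv in \<open>simp add: add.assoc\<close>)
    moreover have "sat U ((!) (b @ concat bs' @ m)) \<phi> \<longleftrightarrow> (\<phi>, [0..<n], concat bs' @ m) \<in> q"
      by (rule sat_iff_mem[OF gl b(1,2) sub(2) \<phi> lists(2)]) (use fv len a(2) b(2) in \<open>simp add: add.assoc\<close>)
    moreover have "(\<phi>, [0..<n], map \<sigma> (concat as @ m)) \<in> q \<longleftrightarrow> (\<phi>, [0..<n], concat as @ m) \<in> q"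
    proof (rule invariant_type_Aut[OF q _ \<sigma>(1)])
      have "m \<in> lists (carrier U)" using m submodel_subset by auto
      then have "concat as @ m \<in> lists (carrier U)" using U(1) by simp
      then show "(\<phi>, [0..<n], concat as @ m) \<in> pformulas L {..<n} (carrier U)"
        using \<phi> fv a(2) by (auto simp: pformulas_def)
    qed
    moreover have "map \<sigma> (concat as @ m) = concat bs' @ m"
      using conc Aut_map_fixes[OF \<sigma>(1) m] by simp
    ultimately show ?thesis by simp
  qed
  have "length (a @ concat as) = length (b @ concat bs')" using a(2) b(2) conc by simp
  moreover have "a @ concat as \<in> lists (carrier U)" "b @ concat bs' \<in> lists (carrier U)" using U by auto
  ultimately obtain \<tau> where \<tau>: "\<tau> \<in> Aut" "map \<tau> (a @ concat as) = b @ concat bs'"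
    using Aut_exists[OF _ _ _ eq] by blast
  have ab: "map \<tau> a = b" and rest: "concat (map (map \<tau>) as) = concat bs'"
    using \<tau>(2) a(2) b(2) by (auto simp: map_concat)
  \<comment> \<open>Concatenation forgets the boundaries between tuples, but all tuples have length
    \<open>n\<close>.\<close>
  have "map (map \<tau>) as = bs'"
  proof (rule concat_injective[OF rest])
    show "length (map (map \<tau>) as) = length bs'" using Cons.prems(3) bs by simp
    show "\<forall>(x, y)\<in>set (zip (map (map \<tau>) as) bs'). length x = length y"
      using Morley_list_length[OF a(3)] Morley_list_length[OF b(3)]
      by (auto dest!: set_zip_leftD set_zip_rightD elim!: in_set_zipE)
  qed
  then show ?case using \<tau>(1) ab bs by auto
qed

text \<open>Saturation realizes \<open>q\<close> over \<open>M\<close>, \<open>Z\<close> and the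
  entries found so far. The set \<open>Z\<close> is for prescribed conjugates over which the new
  sequence has to be generic.\<close>

lemma Morley_list_exists:
  assumes q: "invariant_type L U {..<n} (carrier M) q" and Z: "finite Z" "Z \<subseteq> carrier U"
  shows "\<exists>cs. length cs = r \<and> Morley_list q n (carrier M \<union> Z) cs"
proof (induction r)
  case (Suc r)
  then obtain cs where cs: "length cs = r" "Morley_list q n (carrier M \<union> Z) cs" by blast
  let ?A = "carrier M \<union> (Z \<union> set (concat cs))"
  have "set (concat cs) \<subseteq> carrier U" using Morley_list_lists[OF cs(2)] unfolding in_lists_conv_set by blast
  then have A: "?A \<subseteq> carrier U" using Z(2) submodel_subset by blast
  have small: "|?A| <o \<kappa>" by (rule small_parameters) (use Z(1) in simp)
  have "q \<subseteq> pformulas L {..<n} (carrier U)" "consistent U q"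
    using q by (auto simp: invariant_type_def global_type_def complete_type_over_def type_over_def)
  then have "type_over L U {..<n} ?A (restrict_type q ?A)"
    unfolding type_over_def consistent_def restrict_type_def pformulas_def by fast
  then obtain a where a: "realizes U a (restrict_type q ?A)"
    using saturated A small unfolding saturated_def by blast
  have "map a [0..<n] \<in> lists (carrier U)" using a unfolding realizes_def by (auto dest: range_subsetD)
  moreover have "sat U ((!) (map a [0..<n] @ c)) \<phi>"
    if "(\<phi>, [0..<n], c) \<in> q" "c \<in> lists ?A" for \<phi> c
  proof -
    have "(\<phi>, [0..<n], c) \<in> restrict_type q ?A" using that by (simp add: restrict_type_def)
    then have "psat U a (\<phi>, [0..<n], c)" using a unfolding realizes_def by blast
    then show ?thesis by simp
  qed
  ultimately have "realizes_over q ?A (map a [0..<n])" by (simp add: realizes_over_def)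
  then have "Morley_list q n (carrier M \<union> Z) (map a [0..<n] # cs)" using cs(2) by (simp add: Un_assoc)
  then show ?case using cs(1) by (metis length_Cons)
qed simp

text \<open>The common solutions of \<phi> along a Morley sequence of length \<open>2 ^ j\<close>
  have rank \<open>N - j\<close>: a generic conjugate sequence put after any given one yields a
  Morley sequence of twice the length, and length \<open>2 ^ N\<close> leaves no solutions.\<close>

lemma evasive_Morley_list:
  assumes q: "invariant_type L U {..<n} (carrier M) q" and \<phi>: "\<phi> \<in> formulas L" "fv \<phi> \<subseteq> {..<length xs + n}"
    and empty: "\<And>as. Morley_list q n (carrier M) as \<Longrightarrow> length as = 2 ^ N \<Longrightarrow> (\<Inter>a\<in>set as. solutions (\<phi>, xs, a)) = {}"
  shows "Morley_list q n (carrier M) as \<Longrightarrow> length as = 2 ^ j \<Longrightarrow> j + k = N \<Longrightarrow>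
    evasive k (\<Inter>a\<in>set as. solutions (\<phi>, xs, a))"
proof (induction k arbitrary: as j)
  case 0
  then show ?case using empty by simp
next
  case (Suc k)
  let ?P = "\<lambda>as. \<Inter>a\<in>set as. solutions (\<phi>, xs, a)"
  have vimage: "(\<lambda>v. \<sigma> \<circ> v) -` ?P (map (map \<sigma>) bs) = ?P bs"
    if "\<sigma> \<in> Aut" "Morley_list q n (carrier M) bs" for \<sigma> bs
  proof -
    have "(\<phi>, xs, b) \<in> pformulas L UNIV (carrier U)" if "b \<in> set bs" for b
      using \<phi> Morley_list_lists[OF \<open>Morley_list q n (carrier M) bs\<close>] that
        Morley_list_length[OF \<open>Morley_list q n (carrier M) bs\<close> that]
      by (auto simp: pformulas_def in_lists_conv_set)
    then have "(\<lambda>v. \<sigma> \<circ> v) -` solutions (\<phi>, xs, map \<sigma> b) = solutions (\<phi>, xs, b)" if "b \<in> set bs" for b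
      using vimage_solutions[OF \<open>\<sigma> \<in> Aut\<close>] that by blast
    then show ?thesis by (simp add: vimage_INT)
  qed
  have "\<exists>h\<in>Aut_action. \<forall>g\<in>F. evasive k (h -` ?P as \<inter> g -` ?P as)" if F: "finite F" "F \<subseteq> Aut_action" for F
  proof -
    have "\<forall>g\<in>F. \<exists>bs. Morley_list q n (carrier M) bs \<and> length bs = length as \<and> g -` ?P as = ?P bs"
    proof
      fix g assume "g \<in> F"
      then obtain \<sigma> where \<sigma>: "\<sigma> \<in> Aut" "g = (\<lambda>v. \<sigma> \<circ> v)" using F(2) unfolding Aut_action_def by blast
      \<comment> \<open>The inverse appears because translates are preimages.\<close>
      let ?bs = "map (map (inv \<sigma>)) as"
      have bs: "Morley_list q n (carrier M) ?bs"
        by (rule Morley_list_Aut[OF q inv_Aut[OF \<sigma>(1)] Suc.prems(1)])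
      have "\<sigma> \<circ> inv \<sigma> = id" using Aut_bij[OF \<sigma>(1)] by (simp add: bij_def surj_iff)
      then have "map (map \<sigma>) ?bs = as" by (simp add: comp_def[symmetric] map_idI)
      with vimage[OF \<sigma>(1) bs] have "g -` ?P as = ?P ?bs" by (simp only: \<sigma>(2))
      with bs show "\<exists>bs. Morley_list q n (carrier M) bs \<and> length bs = length as \<and> g -` ?P as = ?P bs"
        by (metis length_map)
    qed
    from bchoice[OF this] obtain B where B: "\<forall>g\<in>F. Morley_list q n (carrier M) (B g) \<and>
        length (B g) = length as \<and> g -` ?P as = ?P (B g)" by blast
    let ?Z = "\<Union>g\<in>F. set (concat (B g))"
    have "finite ?Z" using F(1) by simp
    moreover have "?Z \<subseteq> carrier U"
    proof (rule UN_least)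
      fix g assume "g \<in> F"
      with B have "Morley_list q n (carrier M) (B g)" by simp
      then have "concat (B g) \<in> lists (carrier U)" by (rule Morley_list_lists)
      then show "set (concat (B g)) \<subseteq> carrier U" by (simp only: in_lists_conv_set subset_eq)
    qed
    \<comment> \<open>One sequence generic over all the conjugates \<open>B g\<close> together, so
      that a single \<open>h\<close> serves the whole family \<open>F\<close>.\<close>
    ultimately obtain cs where cs: "length cs = length as" "Morley_list q n (carrier M \<union> ?Z) cs"
      using Morley_list_exists[OF q] by blast
    have csM: "Morley_list q n (carrier M) cs" by (rule Morley_list_mono[OF cs(2)]) simp
    then obtain \<tau> where \<tau>: "\<tau> \<in> Aut" "map (map \<tau>) cs = as"
      using Morley_list_unique[OF q _ Suc.prems(1) cs(1)] by blast
    let ?h = "\<lambda>v. \<tau> \<circ> v"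
    have h: "?h -` ?P as = ?P cs" using vimage[OF \<tau>(1) csM] \<tau>(2) by simp
    have "evasive k (?h -` ?P as \<inter> g -` ?P as)" if g: "g \<in> F" for g
    proof -
      have Bg: "Morley_list q n (carrier M) (B g)" "length (B g) = length as" "g -` ?P as = ?P (B g)"
        using B g by auto
      have "Morley_list q n (carrier M) (cs @ B g)"
        by (rule Morley_list_append[OF cs(2) Bg(1)]) (use g in blast)
      moreover have "length (cs @ B g) = 2 ^ Suc j" using cs(1) Bg(2) Suc.prems(2) by simp
      ultimately have "evasive k (?P (cs @ B g))" using Suc.IH[of "cs @ B g" "Suc j"] Suc.prems(3) by simp
      moreover have "?P (cs @ B g) = ?P cs \<inter> ?P (B g)" by (simp add: INF_union)
      ultimately show ?thesis using h Bg(3) by simp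
    qed
    moreover have "?h \<in> Aut_action" unfolding Aut_action_def using \<tau>(1) by blast
    ultimately show ?thesis by blast
  qed
  then show ?case by simp
qed

text \<open>Dividing along one Morley sequence bounds the length of consistent ones: by uniqueness
  up to conjugation, every Morley list of length \<open>2 ^ N\<close> is inconsistent once one is.
  The formula itself corresponds to the list \<open>[b]\<close> of length
  \<open>2 ^ 0\<close>.\<close>

lemma Kim_divides_evasive:
  assumes "\<chi> \<in> pformulas L J (carrier U)" "Kim_divides L U (carrier M) \<chi>"
  shows "\<exists>n. evasive n (solutions \<chi>)"
proof -
  obtain \<phi> xs b where \<chi>: "\<chi> = (\<phi>, xs, b)" by (cases \<chi>)
  define n where "n = length b"
  obtain q s where q: "invariant_type L U {..<n} (carrier M) q" and tp: "tp_list L U b (carrier M) \<subseteq> q"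
    and s: "Morley_sequence U {..<n} (carrier M) q s"
    and incons: "\<not> consistent U (range (\<lambda>i. (\<phi>, xs, map (s i) [0..<n])))"
    using assms(2) by (auto simp: Kim_divides_def \<chi> n_def)
  have gl: "global_type L U {..<n} q" using q by (simp add: invariant_type_def)
  have \<phi>: "\<phi> \<in> formulas L" "fv \<phi> \<subseteq> {..<length xs + n}" and bU: "b \<in> lists (carrier U)"
    using assms(1) by (auto simp: \<chi> pformulas_def n_def)
  obtain F where F: "finite F" "F \<subseteq> range (\<lambda>i. (\<phi>, xs, map (s i) [0..<n]))" "\<nexists>v. realizes U v F"
    using incons unfolding consistent_def by blast
  obtain K where K: "finite K" "F = (\<lambda>i. (\<phi>, xs, map (s i) [0..<n])) ` K"
    using finite_subset_image[OF F(1,2)] by blast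
  obtain N where "\<forall>i\<in>K. i < N" using K(1) finite_nat_set_iff_bounded by blast
  \<comment> \<open>A bound by a power of two suits the doubling of lengths.\<close>
  then have N: "\<forall>i\<in>K. i < 2 ^ N" using less_exp less_trans by blast
  \<comment> \<open>Initial segments of the given sequence, reversed so that the last element is the
    head.\<close>
  define S where "S r = map (\<lambda>i. map (s i) [0..<n]) (rev [0..<r])" for r
  have S: "Morley_list q n (carrier M) (S r)" for r
  proof (induction r)
    case (Suc r)
    have r: "realizes U (s r) (restrict_type q (carrier M \<union> (\<Union>j<r. s j ` {..<n})))"
      using s unfolding Morley_sequence_def by blast
    have set: "set (concat (S r)) = (\<Union>j<r. s j ` {..<n})" by (auto simp: S_def)
    have "realizes_over q (carrier M \<union> set (concat (S r))) (map (s r) [0..<n])"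
      unfolding realizes_over_def set
    proof (intro conjI allI impI)
      show "map (s r) [0..<n] \<in> lists (carrier U)" using r unfolding realizes_def by (auto dest: range_subsetD)
      fix \<psi> c assume "(\<psi>, [0..<length (map (s r) [0..<n])], c) \<in> q \<and> c \<in> lists (carrier M \<union> (\<Union>j<r. s j ` {..<n}))"
      then have "(\<psi>, [0..<n], c) \<in> restrict_type q (carrier M \<union> (\<Union>j<r. s j ` {..<n}))"
        by (simp add: restrict_type_def)
      then have "psat U (s r) (\<psi>, [0..<n], c)" using r unfolding realizes_def by blast
      then show "sat U ((!) (map (s r) [0..<n] @ c)) \<psi>" by simp
    qed
    then show ?case using Suc by (simp add: S_def)
  qed (simp add: S_def)
  have "(\<Inter>a\<in>set as. solutions (\<phi>, xs, a)) = {}"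
    if as: "Morley_list q n (carrier M) as" "length as = 2 ^ N" for as
  proof (rule ccontr)
    assume "(\<Inter>a\<in>set as. solutions (\<phi>, xs, a)) \<noteq> {}"
    then obtain v where v: "\<And>a. a \<in> set as \<Longrightarrow> v \<in> solutions (\<phi>, xs, a)" by blast
    have "length as = length (S (2 ^ N))" using as(2) by (simp add: S_def)
    then obtain \<sigma> where \<sigma>: "\<sigma> \<in> Aut" "map (map \<sigma>) as = S (2 ^ N)"
      using Morley_list_unique[OF q as(1) S] by blast
    have "as \<noteq> []" using as(2) by auto
    then have "range v \<subseteq> carrier U" using v[OF hd_in_set] by (simp add: solutions_def)
    then have ran: "range (\<sigma> \<circ> v) \<subseteq> carrier U" by (simp only: Aut_range[OF \<sigma>(1)])
    have "psat U (\<sigma> \<circ> v) \<theta>" if \<theta>: "\<theta> \<in> F" for \<theta>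
    proof -
      obtain i where i: "i < 2 ^ N" "\<theta> = (\<phi>, xs, map (s i) [0..<n])" using \<theta> K(2) N by auto
      then have "map (s i) [0..<n] \<in> set (S (2 ^ N))" by (auto simp: S_def)
      then obtain a where a: "a \<in> set as" "map (s i) [0..<n] = map \<sigma> a" unfolding \<sigma>(2)[symmetric] by auto
      have "(\<phi>, xs, a) \<in> pformulas L UNIV (carrier U)"
        using \<phi> Morley_list_lists[OF as(1)] a(1) Morley_list_length[OF as(1) a(1)]
        by (auto simp: pformulas_def in_lists_conv_set)
      from vimage_solutions[OF \<sigma>(1) this] v[OF a(1)] have "\<sigma> \<circ> v \<in> solutions (\<phi>, xs, map \<sigma> a)"
        by blast
      then show ?thesis by (simp add: i(2) a(2) solutions_def)
    qed
    with ran F(3) show False unfolding realizes_def by blast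
  qed
  moreover have "Morley_list q n (carrier M) [b]"
  proof -
    \<comment> \<open>The type of \<open>b\<close> over \<open>M\<close> is complete: a formula of
      \<open>q\<close> over \<open>M\<close> that failed at \<open>b\<close> would put its own
      negation into \<open>q\<close>.\<close>
    have "sat U ((!) (b @ c)) \<psi>" if \<psi>: "(\<psi>, [0..<n], c) \<in> q" "c \<in> lists (carrier M)" for \<psi> c
    proof (rule ccontr)
      assume neg: "\<not> sat U ((!) (b @ c)) \<psi>"
      have pf: "(\<psi>, [0..<n], c) \<in> pformulas L {..<n} (carrier U)"
        using gl \<psi>(1) by (auto simp: global_type_def complete_type_over_def type_over_def)
      have "map ((!) b) [0..<n] = b" by (simp add: n_def map_nth)
      then have "(Neg \<psi>, [0..<n], c) \<in> tp_list L U b (carrier M)"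
        using neg pf \<psi>(2) by (auto simp: tp_list_def tp_def pformulas_def formulas_def n_def)
      then show False using tp global_type_neg[OF gl pf] \<psi>(1) by blast
    qed
    then show ?thesis using bU by (simp add: realizes_over_def n_def)
  qed
  ultimately have "evasive N (\<Inter>a\<in>set [b]. solutions (\<phi>, xs, a))"
    using evasive_Morley_list[OF q \<phi>, of N "[b]" 0 N] by simp
  then show ?thesis using \<chi> by auto
qed

lemma Kim_forks_small:
  assumes "Kim_forks L U (carrier M) \<chi>"
  shows "small (solutions \<chi>)"
proof -
  obtain \<phi> xs b where \<chi>: "\<chi> = (\<phi>, xs, b)" by (cases \<chi>)
  obtain D where D: "finite D" "D \<subseteq> pformulas L (set xs) (carrier U)" "\<forall>\<theta>\<in>D. Kim_divides L U (carrier M) \<theta>"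
    "\<forall>v. range v \<subseteq> carrier U \<and> psat U v \<chi> \<longrightarrow> (\<exists>\<theta>\<in>D. psat U v \<theta>)"
    using assms unfolding Kim_forks_def \<chi> by (auto simp del: psat.simps)
  have "\<forall>P\<in>solutions ` D. \<exists>n. evasive n P"
    using D(2,3) Kim_divides_evasive by blast
  moreover have "solutions \<chi> \<subseteq> \<Union>(solutions ` D)"
    using D(4) unfolding solutions_def by blast
  ultimately show ?thesis unfolding small_def using D(1) by (meson finite_imageI)
qed

subsection \<open>Coheirs\<close>

definition submodel_points :: "('v \<Rightarrow> 'a) set" where
  "submodel_points = {m. range m \<subseteq> carrier M}"

lemma submodel_points_carrier: "m \<in> submodel_points \<Longrightarrow> range m \<subseteq> carrier U"
  using submodel_subset unfolding submodel_points_def by blast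

text \<open>The average type of an ultrafilter. When the ultrafilter contains
  \<open>submodel_points\<close>, the type is finitely satisfiable in \<open>M\<close>, as a coheir
  is usually described.\<close>

definition coheir :: "'v set \<Rightarrow> ('v \<Rightarrow> 'a) set set \<Rightarrow> ('a, 'f, 'r, 'v) pfm set" where
  "coheir I \<D> = {\<chi> \<in> pformulas L I (carrier U). {m. psat U m \<chi>} \<in> \<D>}"

text \<open>Exchange the roles of variables and parameters: for \<open>m\<close> in
  \<open>M\<close>, \<phi>(m; y) is a formula over \<open>M\<close>, so it cannot separate
  \<open>c\<close> from \<open>c'\<close>.\<close>

lemma equiv_over_psat:
  assumes "equiv_over L U (carrier M) c c'" "\<phi> \<in> formulas L" "fv \<phi> \<subseteq> {..<length xs + length c}"
    and "m \<in> submodel_points"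
  shows "psat U m (\<phi>, xs, c) \<longleftrightarrow> psat U m (\<phi>, xs, c')"
proof -
  have len: "length c' = length c" and tp: "tp_list L U c (carrier M) = tp_list L U c' (carrier M)"
    using assms(1) by (auto simp: equiv_over_def)
  let ?u = "map Inr (map m xs) @ map Inl [0..<length c]"
  let ?w = "map Inl [0..<length c] @ map Inr (map m xs)"
  have fv: "fv \<phi> \<subseteq> {..<length ?u}" using assms(3) by simp
  have sub: "set ?u \<subseteq> set ?w" by auto
  obtain \<psi> where \<psi>: "\<psi> \<in> formulas L" "fv \<psi> \<subseteq> {..<length ?w}"
    "\<And>h. sat U ((!) (map h ?w)) \<psi> \<longleftrightarrow> sat U ((!) (map h ?u)) \<phi>"
    by (rule reindex_formula[OF assms(2) fv sub]) (rule that)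
  have u: "map (case_sum ((!) d) id) ?u = map m xs @ d" if "length d = length c" for d
    using that map_nth[of d] by (simp add: comp_def)
  have w: "map (case_sum ((!) d) id) ?w = map ((!) d) [0..<length c] @ map m xs" for d
    by (simp add: comp_def)
  have eq: "psat U m (\<phi>, xs, d) \<longleftrightarrow> psat U ((!) d) (\<psi>, [0..<length c], map m xs)" if "length d = length c" for d
    using \<psi>(3)[of "case_sum ((!) d) id"] unfolding u[OF that] w psat.simps by (rule sym)
  have "map m xs \<in> lists (carrier M)" using assms(4) by (auto simp: submodel_points_def dest: range_subsetD)
  then have pf: "(\<psi>, [0..<length c], map m xs) \<in> pformulas L {..<length c} (carrier M)"
    using \<psi>(1,2) by (auto simp: pformulas_def)
  have "psat U ((!) d) (\<psi>, [0..<length c], map m xs) \<longleftrightarrow>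
      (\<psi>, [0..<length c], map m xs) \<in> tp_list L U d (carrier M)" if "length d = length c" for d
    using pf that by (simp add: tp_list_def tp_def del: psat.simps)
  then show ?thesis using eq[OF refl] eq[OF len] len tp by (simp only:)
qed

text \<open>Formulas with parameters conjugate over \<open>M\<close> agree at all points of
  \<open>M\<close>, and these form a large set; the same set witnesses finite
  satisfiability.\<close>

lemma coheir_invariant:
  assumes D: "ultrafilter \<D>" "submodel_points \<in> \<D>"
  shows "invariant_type L U I (carrier M) (coheir I \<D>)"
proof -
  have "\<exists>a. realizes U a F" if F: "finite F" "F \<subseteq> coheir I \<D>" for F
  proof -
    have "(\<Inter>\<chi>\<in>F. {m. psat U m \<chi>}) \<in> \<D>"
      by (rule ultrafilter_INT[OF D(1) F(1)]) (use F(2) in \<open>auto simp: coheir_def\<close>)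
    then have "(\<Inter>\<chi>\<in>F. {m. psat U m \<chi>}) \<inter> submodel_points \<noteq> {}"
      using ultrafilter_nonempty[OF D(1)] ultrafilter_Int[OF D(1) _ D(2)] by blast
    then obtain m where "m \<in> submodel_points" "\<forall>\<chi>\<in>F. psat U m \<chi>" by blast
    then show ?thesis using submodel_points_carrier unfolding realizes_def by blast
  qed
  then have "consistent U (coheir I \<D>)" by (simp add: consistent_def)
  moreover have "coheir I \<D> \<subseteq> pformulas L I (carrier U)" unfolding coheir_def by blast
  moreover have "(\<phi>, xs, c) \<in> coheir I \<D> \<or> (Neg \<phi>, xs, c) \<in> coheir I \<D>"
    if "(\<phi>, xs, c) \<in> pformulas L I (carrier U)" for \<phi> xs c
  proof -
    have "(Neg \<phi>, xs, c) \<in> pformulas L I (carrier U)" using that by (simp add: pformulas_def formulas_def)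
    moreover have "{m. psat U m (Neg \<phi>, xs, c)} = - {m. psat U m (\<phi>, xs, c)}" by auto
    ultimately show ?thesis
      using that ultrafilter_Compl[OF D(1)] unfolding coheir_def by (simp del: psat.simps)
  qed
  ultimately have "global_type L U I (coheir I \<D>)"
    unfolding global_type_def complete_type_over_def type_over_def by blast
  moreover have "(\<phi>, xs, c) \<in> coheir I \<D> \<longleftrightarrow> (\<phi>, xs, c') \<in> coheir I \<D>"
    if c: "(\<phi>, xs, c) \<in> pformulas L I (carrier U)" "c' \<in> lists (carrier U)" "equiv_over L U (carrier M) c c'"
    for \<phi> xs c c'
  proof -
    have \<phi>: "\<phi> \<in> formulas L" "fv \<phi> \<subseteq> {..<length xs + length c}" using c(1) by (auto simp: pformulas_def)
    have c': "(\<phi>, xs, c') \<in> pformulas L I (carrier U)"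
      using c by (auto simp: pformulas_def equiv_over_def)
    have eq: "psat U m (\<phi>, xs, c) \<longleftrightarrow> psat U m (\<phi>, xs, c')" if "m \<in> submodel_points" for m
      by (rule equiv_over_psat[OF c(3) \<phi> that])
    have "{m. psat U m (\<phi>, xs, c)} \<inter> submodel_points \<subseteq> {m. psat U m (\<phi>, xs, c')}"
      "{m. psat U m (\<phi>, xs, c')} \<inter> submodel_points \<subseteq> {m. psat U m (\<phi>, xs, c)}"
      using eq by blast+
    then have "{m. psat U m (\<phi>, xs, c)} \<in> \<D> \<longleftrightarrow> {m. psat U m (\<phi>, xs, c')} \<in> \<D>"
      using ultrafilter_mono[OF D(1)] ultrafilter_Int[OF D(1) _ D(2)] by blast
    then show ?thesis using c(1) c' unfolding coheir_def by (simp del: psat.simps)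
  qed
  ultimately show ?thesis unfolding invariant_type_def by blast
qed

text \<open>The restriction of \<open>a\<close> to \<open>J\<close> realizes the complete type over
  \<open>M\<close> given by the ultrafilter. One implication is required; negation supplies the
  other.\<close>

definition matches :: "('v \<Rightarrow> 'a) set set \<Rightarrow> 'v set \<Rightarrow> ('v \<Rightarrow> 'a) \<Rightarrow> bool" where
  "matches \<D> J a \<longleftrightarrow> range a \<subseteq> carrier U \<and>
     (\<forall>R. definable L U J (carrier M) R \<longrightarrow> {x. R x} \<in> \<D> \<longrightarrow> R a)"

lemma matches_mono: "matches \<D> J a \<Longrightarrow> J' \<subseteq> J \<Longrightarrow> matches \<D> J' a"
  unfolding matches_def using definable_mono[of L U J' "carrier M" _ J "carrier M"] by blast

lemma matches_iff:
  assumes "ultrafilter \<D>" "matches \<D> J a" "definable L U J (carrier M) R"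
  shows "R a \<longleftrightarrow> {x. R x} \<in> \<D>"
proof -
  have "{x. \<not> R x} \<in> \<D> \<longleftrightarrow> {x. R x} \<notin> \<D>"
    using ultrafilter_Compl[OF assms(1), of "{x. R x}"] by (simp add: Compl_eq)
  moreover have "{x. R x} \<in> \<D> \<Longrightarrow> R a" "{x. \<not> R x} \<in> \<D> \<Longrightarrow> \<not> R a"
    using assms(2,3) definable_neg[OF assms(3)] unfolding matches_def by blast+
  ultimately show ?thesis by blast
qed

text \<open>Saturation is stated for variables below some \<open>n\<close>, so the finite set
  \<open>J\<close> is renumbered by \<open>f\<close> and read back by \<open>g\<close>.\<close>

lemma matches_exists:
  fixes \<D> :: "('v \<Rightarrow> 'a) set set"
  assumes D: "ultrafilter \<D>" "submodel_points \<in> \<D>" and J: "finite J"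
  obtains a where "matches \<D> J a"
proof -
  obtain f :: "'v \<Rightarrow> nat" and n where f: "f ` J = {i. i < n}" "inj_on f J"
    using finite_imp_inj_to_nat_seg[OF J] by blast
  define g where "g = inv_into J f"
  have gf: "g (f j) = j" if "j \<in> J" for j using that f(2) by (simp add: g_def)
  define p where "p = {\<chi> \<in> pformulas L {..<n} (carrier M). {x. psat U (x \<circ> g) \<chi>} \<in> \<D>}"
  have "\<exists>a. realizes U a F" if F: "finite F" "F \<subseteq> p" for F
  proof -
    have "(\<Inter>\<chi>\<in>F. {x. psat U (x \<circ> g) \<chi>}) \<in> \<D>"
      by (rule ultrafilter_INT[OF D(1) F(1)]) (use F(2) in \<open>auto simp: p_def\<close>)
    then have "(\<Inter>\<chi>\<in>F. {x. psat U (x \<circ> g) \<chi>}) \<inter> submodel_points \<noteq> {}"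
      using ultrafilter_nonempty[OF D(1)] ultrafilter_Int[OF D(1) _ D(2)] by blast
    then obtain x where x: "x \<in> submodel_points" "\<forall>\<chi>\<in>F. psat U (x \<circ> g) \<chi>" by blast
    have "range (x \<circ> g) \<subseteq> carrier U" using submodel_points_carrier[OF x(1)] by auto
    then show ?thesis using x(2) unfolding realizes_def by blast
  qed
  then have "type_over L U {..<n} (carrier M) p"
    unfolding type_over_def consistent_def p_def by blast
  then obtain b where b: "realizes U b p"
    using saturated submodel_subset submodel_small unfolding saturated_def by blast
  have ran: "range (b \<circ> f) \<subseteq> carrier U" using b unfolding realizes_def by auto
  have "R (b \<circ> f)" if R: "definable L U J (carrier M) R" "{x. R x} \<in> \<D>" for R
  proof -
    obtain \<phi> xs c where \<chi>: "(\<phi>, xs, c) \<in> pformulas L J (carrier M)" "distinct xs"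
      and Rp: "\<And>a. range a \<subseteq> carrier U \<Longrightarrow> R a \<longleftrightarrow> psat U a (\<phi>, xs, c)"
      by (rule definable_imp_pformula[OF R(1)]) (rule that)
    have xs: "set xs \<subseteq> J" using \<chi>(1) by (auto simp: pformulas_def)
    have "f j < n" if "j \<in> J" for j using that f(1) by blast
    with xs have ys: "map f xs \<in> lists {..<n}" by (auto simp: subset_iff)
    have "psat U (x \<circ> g) (\<phi>, map f xs, c) \<longleftrightarrow> psat U x (\<phi>, xs, c)" for x
    proof -
      have "map (x \<circ> g) (map f xs) = map x xs" using gf xs by (auto simp: subset_iff)
      then show ?thesis by (simp only: psat.simps)
    qed
    then have "{x. R x} \<inter> submodel_points \<subseteq> {x. psat U (x \<circ> g) (\<phi>, map f xs, c)}"
      using Rp submodel_points_carrier by blast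
    then have "{x. psat U (x \<circ> g) (\<phi>, map f xs, c)} \<in> \<D>"
      using ultrafilter_mono[OF D(1)] ultrafilter_Int[OF D(1) R(2) D(2)] by blast
    moreover have "(\<phi>, map f xs, c) \<in> pformulas L {..<n} (carrier M)"
      using \<chi>(1) ys by (simp add: pformulas_def)
    ultimately have "psat U b (\<phi>, map f xs, c)" using b unfolding realizes_def p_def by blast
    then have "psat U (b \<circ> f) (\<phi>, xs, c)" by simp
    then show ?thesis using Rp[OF ran] by blast
  qed
  then show thesis using ran that unfolding matches_def by blast
qed

lemma matches_conjugate:
  assumes D: "ultrafilter \<D>" and "finite J" "matches \<D> J a" "matches \<D> J e"
  obtains \<sigma> where "\<sigma> \<in> Aut" "\<And>j. j \<in> J \<Longrightarrow> \<sigma> (e j) = a j"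
proof -
  obtain js where js: "set js = J" using finite_list[OF assms(2)] by blast
  have ran: "range a \<subseteq> carrier U" "range e \<subseteq> carrier U" using assms(3,4) by (simp_all add: matches_def)
  have "sat U ((!) (map e js @ m)) \<phi> \<longleftrightarrow> sat U ((!) (map a js @ m)) \<phi>"
    if "\<phi> \<in> formulas L" "m \<in> lists (carrier M)" "fv \<phi> \<subseteq> {..<length (map e js) + length m}" for \<phi> m
  proof -
    have "(\<phi>, js, m) \<in> pformulas L J (carrier M)" using that js by (auto simp: pformulas_def)
    then have "definable L U J (carrier M) (\<lambda>a. psat U a (\<phi>, js, m))" by (rule definable_pformula)
    from matches_iff[OF D assms(3) this] matches_iff[OF D assms(4) this] show ?thesis by simp
  qed
  moreover have "map e js \<in> lists (carrier U)" "map a js \<in> lists (carrier U)"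
    using ran by (auto dest: range_subsetD)
  ultimately obtain \<sigma> where "\<sigma> \<in> Aut" "map \<sigma> (map e js) = map a js"
    using Aut_exists[of "map e js" "map a js"] by auto
  then show thesis using that[of \<sigma>] js by auto
qed

text \<open>The relations whose instances the second ultrafilter has to omit: \<open>Inl\<close>
  carries x, \<open>Inr\<close> carries y, and the fibre over a realization of the completion is
  small. The choice of realization is immaterial by \<open>small_fibre\<close>.\<close>

definition avoided :: "('v \<Rightarrow> 'a) set set \<Rightarrow> 'v set \<Rightarrow> (('v + 'a \<Rightarrow> 'a) \<Rightarrow> bool) \<Rightarrow> bool" where
  "avoided \<D> I R \<longleftrightarrow> (\<exists>J a. finite J \<and> J \<subseteq> I \<and> definable L U (J <+> UNIV) (carrier M) R \<and>
     matches \<D> J a \<and> small {v. range v \<subseteq> carrier U \<and> R (case_sum a v)})"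

lemma range_case_sum: "range (case_sum a v) \<subseteq> A \<longleftrightarrow> range a \<subseteq> A \<and> range v \<subseteq> A"
proof
  assume "range (case_sum a v) \<subseteq> A"
  then have "case_sum a v (Inl i) \<in> A" "case_sum a v (Inr j) \<in> A" for i j by (blast intro: rangeI)+
  then show "range a \<subseteq> A \<and> range v \<subseteq> A" by auto
next
  assume av: "range a \<subseteq> A \<and> range v \<subseteq> A"
  have "case_sum a v z \<in> A" for z using av by (cases z) auto
  then show "range (case_sum a v) \<subseteq> A" by blast
qed

text \<open>Both tuples realize the same type over \<open>M\<close>; an automorphism taking one to
  the other translates one fibre into the other.\<close>

lemma small_fibre:
  assumes D: "ultrafilter \<D>" and J: "finite J" and R: "definable L U (J <+> UNIV) (carrier M) R"
    and a: "matches \<D> J a" and e: "matches \<D> J e"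
    and small: "small {v. range v \<subseteq> carrier U \<and> R (case_sum a v)}"
  shows "small {v. range v \<subseteq> carrier U \<and> R (case_sum e v)}"
proof -
  obtain \<sigma> where \<sigma>: "\<sigma> \<in> Aut" "\<And>j. j \<in> J \<Longrightarrow> \<sigma> (e j) = a j"
    by (rule matches_conjugate[OF D J a e]) (rule that)
  have ran: "range a \<subseteq> carrier U" "range e \<subseteq> carrier U" using a e by (simp_all add: matches_def)
  have "R (case_sum a (\<sigma> \<circ> v)) \<longleftrightarrow> R (case_sum e v)" if v: "range v \<subseteq> carrier U" for v
  proof -
    have r: "range (case_sum a (\<sigma> \<circ> v)) \<subseteq> carrier U" "range (case_sum e v) \<subseteq> carrier U"
      using ran v by (simp_all only: range_case_sum Aut_range[OF \<sigma>(1)] simp_thms)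
    have "R (case_sum a (\<sigma> \<circ> v)) \<longleftrightarrow> R (\<sigma> \<circ> case_sum e v)"
    proof (rule definable_depends[OF R r(1)])
      show "range (\<sigma> \<circ> case_sum e v) \<subseteq> carrier U" using r(2) by (simp only: Aut_range[OF \<sigma>(1)])
      show "case_sum a (\<sigma> \<circ> v) i = (\<sigma> \<circ> case_sum e v) i" if "i \<in> J <+> UNIV" for i
        using that \<sigma>(2) by auto
    qed
    also have "\<dots> \<longleftrightarrow> R (case_sum e v)" by (rule Aut_definable[OF \<sigma>(1) R r(2)])
    finally show ?thesis .
  qed
  then have eq: "(\<lambda>v. \<sigma> \<circ> v) -` {v. range v \<subseteq> carrier U \<and> R (case_sum a v)} =
      {v. range v \<subseteq> carrier U \<and> R (case_sum e v)}"
    unfolding vimage_Collect_eq Aut_range[OF \<sigma>(1)] by (simp only: cong: conj_cong)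
  have "(\<lambda>v. \<sigma> \<circ> v) \<in> Aut_action" unfolding Aut_action_def using \<sigma>(1) by (rule imageI)
  from small_vimage[OF small this] show ?thesis unfolding eq .
qed

text \<open>A union of small sets quasi-divides, and by elementarity the finite tuple of conjugates
  witnessing this can be found in \<open>M\<close>. As \<open>v\<close> cannot lie in all of the corresponding sets, one of
  these conjugates avoids every \<open>R \<in> \<R>\<close>.\<close>

lemma avoid_in_submodel:
  fixes \<D> :: "('v \<Rightarrow> 'a) set set"
  assumes D: "ultrafilter \<D>" "submodel_points \<in> \<D>"
    and \<R>: "finite \<R>" "\<And>R. R \<in> \<R> \<Longrightarrow> avoided \<D> I R"
    and Q: "definable L U I (carrier M) Q" "{x. Q x} \<in> \<D>" and v: "range v \<subseteq> carrier U"
  obtains m where "m \<in> submodel_points" "Q m" "\<And>R. R \<in> \<R> \<Longrightarrow> \<not> R (case_sum m v)"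
proof -
  obtain J0 where J0: "finite J0" "J0 \<subseteq> I" "definable L U J0 (carrier M) Q"
    by (rule definable_finite_vars[OF Q(1)]) (rule that)
  have "\<forall>R\<in>\<R>. \<exists>J. finite J \<and> definable L U (J <+> UNIV) (carrier M) R \<and> (\<exists>a. matches \<D> J a \<and>
      small {v. range v \<subseteq> carrier U \<and> R (case_sum a v)})"
    using \<R>(2) unfolding avoided_def by blast
  from bchoice[OF this] obtain J where J: "\<forall>R\<in>\<R>. finite (J R) \<and> definable L U (J R <+> UNIV) (carrier M) R \<and>
      (\<exists>a. matches \<D> (J R) a \<and> small {v. range v \<subseteq> carrier U \<and> R (case_sum a v)})" by blast
  \<comment> \<open>Variables of \<open>Q\<close> and of all members of \<R> together, so that a
    single tuple \<open>e\<close> serves them all.\<close>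
  let ?J = "J0 \<union> (\<Union>R\<in>\<R>. J R)"
  have "finite ?J" using J0(1) \<R>(1) J by simp
  then obtain e where e: "matches \<D> ?J e"
    by (rule matches_exists[OF D]) (rule that)
  have ran: "range e \<subseteq> carrier U" using e by (simp add: matches_def)
  define A where "A R = {v. range v \<subseteq> carrier U \<and> R (case_sum e v)}"
    for R :: "('v + 'a \<Rightarrow> 'a) \<Rightarrow> bool"
  have "small (A R)" if "R \<in> \<R>" for R
  proof -
    have "J R \<subseteq> ?J" using that by blast
    from matches_mono[OF e this] have eR: "matches \<D> (J R) e" .
    obtain a where a: "matches \<D> (J R) a" "small {v. range v \<subseteq> carrier U \<and> R (case_sum a v)}"
      using J \<open>R \<in> \<R>\<close> by blast
    show ?thesis unfolding A_def
      by (rule small_fibre[OF D(1) _ _ a(1) eR a(2)]) (use J that in simp_all)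
  qed
  then have "quasi_divides (\<Union>R\<in>\<R>. A R)" by (intro small_quasi_divides small_UN \<R>(1))
  then obtain F where F: "finite F" "F \<subseteq> Aut_action" "(\<Inter>g\<in>F. g -` (\<Union>R\<in>\<R>. A R)) = {}"
    unfolding quasi_divides_def by blast
  have "\<forall>g\<in>F. \<exists>\<sigma>. \<sigma> \<in> Aut \<and> g = (\<lambda>v. \<sigma> \<circ> v)" using F(2) unfolding Aut_action_def by blast
  from bchoice[OF this] obtain s where s: "\<forall>g\<in>F. s g \<in> Aut \<and> g = (\<lambda>v. s g \<circ> v)" by blast
  \<comment> \<open>All conjugates of \<open>e\<close> in one assignment: the block marked by
    \<open>g\<close> is the image of \<open>e\<close> under the inverse of \<open>s g\<close>, and
    blocks outside \<open>F\<close> are filled with \<open>e\<close>.\<close>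
  define E where "E z = (if fst z \<in> F then inv (s (fst z)) (e (snd z)) else e (snd z))" for z
  have E: "E \<circ> Pair g = inv (s g) \<circ> e" if "g \<in> F" for g using that by (simp add: E_def fun_eq_iff)
  have ranE: "range E \<subseteq> carrier U"
  proof -
    have "E z \<in> carrier U" for z
    proof (cases "fst z \<in> F")
      case True
      then have "inv (s (fst z)) \<in> Aut" using s inv_Aut by blast
      then show ?thesis using True Aut_carrier ran by (auto simp: E_def)
    qed (use ran in \<open>auto simp: E_def\<close>)
    then show ?thesis by blast
  qed
  \<comment> \<open>The pattern to be found in \<open>M\<close>: every block satisfies
    \<open>Q\<close>, and no \<open>v\<close> lies in the union of the fibres over every
    block.\<close>
  define T where "T E' \<longleftrightarrow> (\<forall>g\<in>F. Q (E' \<circ> Pair g)) \<and> \<not> (\<exists>v. range v \<subseteq> carrier U \<and>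
      (\<forall>g\<in>F. \<exists>R\<in>\<R>. R (case_sum E' v \<circ> map_sum (Pair g) id)))" for E'
  have "definable L U UNIV (carrier M) T"
    unfolding T_def
  proof (intro definable_conj definable_neg definable_Ball F(1))
    fix g assume "g \<in> F"
    show "definable L U UNIV (carrier M) (\<lambda>E'. Q (E' \<circ> Pair g))"
      by (rule definable_reindex[OF J0(3)]) simp
  next
    have "carrier U \<noteq> {}" using submodel_nonempty submodel_subset by blast
    moreover have "definable L U (UNIV <+> UNIV) (carrier M)
        (\<lambda>z. \<forall>g\<in>F. \<exists>R\<in>\<R>. R (z \<circ> map_sum (Pair g) id))"
    proof (intro definable_Ball definable_Bex F(1) \<R>(1))
      fix g R assume "R \<in> \<R>"
      with J have "definable L U (J R <+> UNIV) (carrier M) R" by blast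
      then show "definable L U (UNIV <+> UNIV) (carrier M) (\<lambda>z. R (z \<circ> map_sum (Pair g) id))"
        by (rule definable_reindex) simp
    qed
    ultimately show "definable L U UNIV (carrier M) (\<lambda>E'. \<exists>v. range v \<subseteq> carrier U \<and>
        (\<forall>g\<in>F. \<exists>R\<in>\<R>. R (case_sum E' v \<circ> map_sum (Pair g) id)))"
      by (intro definable_Ex)
  qed
  moreover have "T E"
    unfolding T_def
  proof (intro conjI ballI notI)
    fix g assume g: "g \<in> F"
    have "matches \<D> J0 e" by (rule matches_mono[OF e]) blast
    then have "Q e" using Q(2) J0(3) unfolding matches_def by blast
    then show "Q (E \<circ> Pair g)"
      using Aut_definable[OF inv_Aut J0(3) ran] s g unfolding E[OF g] by blast
  next
    assume "\<exists>v. range v \<subseteq> carrier U \<and> (\<forall>g\<in>F. \<exists>R\<in>\<R>. R (case_sum E v \<circ> map_sum (Pair g) id))"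
    then obtain w where w: "range w \<subseteq> carrier U"
      "\<And>g. g \<in> F \<Longrightarrow> \<exists>R\<in>\<R>. R (case_sum E w \<circ> map_sum (Pair g) id)" by blast
    \<comment> \<open>Apply \<open>s g\<close> to the block and to \<open>w\<close>: the block
      returns to \<open>e\<close>, so \<open>s g \<circ> w\<close> lies in a fibre over
      \<open>e\<close>.\<close>
    have "w \<in> g -` (\<Union>R\<in>\<R>. A R)" if g: "g \<in> F" for g
    proof -
      obtain R where R: "R \<in> \<R>" "R (case_sum E w \<circ> map_sum (Pair g) id)" using w(2)[OF g] by blast
      have sg: "s g \<in> Aut" and gs: "g w = s g \<circ> w" using s g by metis+
      have "s g (inv (s g) x) = x" for x using Aut_bij[OF sg] by (simp add: bij_def surj_f_inv_f)
      then have "s g \<circ> (case_sum E w \<circ> map_sum (Pair g) id) = case_sum e (s g \<circ> w)"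
        using g by (auto simp: fun_eq_iff E_def split: sum.split)
      moreover have "range (case_sum E w \<circ> map_sum (Pair g) id) \<subseteq> carrier U"
      proof -
        have "range (case_sum E w) \<subseteq> carrier U" using ranE w(1) by (simp only: range_case_sum simp_thms)
        then show ?thesis by auto
      qed
      moreover have "definable L U (J R <+> UNIV) (carrier M) R" using J R(1) by blast
      ultimately have "R (case_sum e (s g \<circ> w))" using Aut_definable[OF sg] R(2) by metis
      then have "s g \<circ> w \<in> A R" unfolding A_def using w(1) Aut_range[OF sg, of w] by blast
      then show ?thesis using R(1) gs by auto
    qed
    then show False using F(3) by blast
  qed
  ultimately obtain m where m: "range m \<subseteq> carrier M" "T m"
    by (rule elementary_submodel_realizes[OF elementary _ ranE]) (rule that)
  have none: "\<not> (\<exists>v. range v \<subseteq> carrier U \<and> (\<forall>g\<in>F. \<exists>R\<in>\<R>. R (case_sum m v \<circ> map_sum (Pair g) id)))"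
    using m(2) unfolding T_def by (rule conjunct2)
  have "\<not> (\<forall>g\<in>F. \<exists>R\<in>\<R>. R (case_sum m v \<circ> map_sum (Pair g) id))"
    by (rule notI, rule notE[OF none], rule exI[of _ v], rule conjI[OF v])
  then obtain g where g: "g \<in> F" "\<And>R. R \<in> \<R> \<Longrightarrow> \<not> R (case_sum m v \<circ> map_sum (Pair g) id)"
    by auto
  have "m \<circ> Pair g \<in> submodel_points" using m(1) unfolding submodel_points_def by auto
  moreover have "Q (m \<circ> Pair g)" using m(2) g(1) unfolding T_def by blast
  moreover have "case_sum m v \<circ> map_sum (Pair g) id = case_sum (m \<circ> Pair g) v"
    by (auto simp: fun_eq_iff split: sum.split)
  ultimately show thesis using g(2) by (intro that[of "m \<circ> Pair g"]) simp_all
qed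

text \<open>By elementarity finite parts of \<open>p\<close> have solutions in \<open>M\<close>,
  which gives a filter base. An ultrafilter above it decides every formula over \<open>M\<close>,
  hence fixes a completion of \<open>p\<close>.\<close>

lemma type_ultrafilter:
  fixes p :: "('a, 'f, 'r, 'v) pfm set"
  assumes p: "type_over L U I (carrier M) p"
  obtains \<D> where "ultrafilter \<D>" "submodel_points \<in> \<D>" "\<And>\<chi>. \<chi> \<in> p \<Longrightarrow> {m. psat U m \<chi>} \<in> \<D>"
proof -
  let ?S = "\<lambda>F. {m \<in> submodel_points. \<forall>\<chi>\<in>F. psat U m \<chi>} :: ('v \<Rightarrow> 'a) set"
  define \<B> where "\<B> = {X. \<exists>F. finite F \<and> F \<subseteq> p \<and> ?S F \<subseteq> X}"
  have memI: "X \<in> \<B>" if "finite F" "F \<subseteq> p" "?S F \<subseteq> X" for X F using that unfolding \<B>_def by blast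
  have "?S F \<noteq> {}" if F: "finite F" "F \<subseteq> p" for F
  proof -
    have "definable L U I (carrier M) (\<lambda>a. \<forall>\<chi>\<in>F. psat U a \<chi>)"
      by (intro definable_Ball F(1) definable_pformula) (use F(2) p in \<open>auto simp: type_over_def\<close>)
    moreover obtain a where "range a \<subseteq> carrier U" "\<forall>\<chi>\<in>F. psat U a \<chi>"
      using p F unfolding type_over_def consistent_def realizes_def by blast
    ultimately obtain m where "range m \<subseteq> carrier M" "\<forall>\<chi>\<in>F. psat U m \<chi>"
      by (rule elementary_submodel_realizes[OF elementary]) (rule that)
    then show ?thesis unfolding submodel_points_def by blast
  qed
  then have "{} \<notin> \<B>" unfolding \<B>_def by blast
  moreover have "X \<inter> Y \<in> \<B>" if XY: "X \<in> \<B>" "Y \<in> \<B>" for X Y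
  proof -
    obtain F G where "finite F" "F \<subseteq> p" "?S F \<subseteq> X" "finite G" "G \<subseteq> p" "?S G \<subseteq> Y"
      using XY unfolding \<B>_def by blast
    then show ?thesis by (intro memI[of "F \<union> G"]) auto
  qed
  moreover have "UNIV \<in> \<B>" by (rule memI[of "{}"]) auto
  ultimately obtain \<D> where \<D>: "ultrafilter \<D>" "\<B> \<subseteq> \<D>"
    using ultrafilter_exists by blast
  moreover have "submodel_points \<in> \<B>" by (rule memI[of "{}"]) auto
  moreover have "{m. psat U m \<chi>} \<in> \<B>" if "\<chi> \<in> p" for \<chi>
    by (rule memI[of "{\<chi>}"]) (use that in auto)
  ultimately show thesis using that by blast
qed

text \<open>\<open>avoid_in_submodel\<close> is exactly the required finite intersection property.
  The result determines the same type over \<open>M\<close> and omits every avoided relation at the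
  one assignment \<open>v\<close>.\<close>

lemma avoiding_ultrafilter:
  fixes \<D> :: "('v \<Rightarrow> 'a) set set"
  assumes D: "ultrafilter \<D>" "submodel_points \<in> \<D>" and v: "range v \<subseteq> carrier U"
  obtains \<E> where "ultrafilter \<E>" "submodel_points \<in> \<E>"
    "\<And>Q. definable L U I (carrier M) Q \<Longrightarrow> {x. Q x} \<in> \<D> \<Longrightarrow> {x. Q x} \<in> \<E>"
    "\<And>R. avoided \<D> I R \<Longrightarrow> {x. \<not> R (case_sum x v)} \<in> \<E>"
proof -
  let ?S = "\<lambda>Q \<R>. {m \<in> submodel_points. Q m \<and> (\<forall>R\<in>\<R>. \<not> R (case_sum m v))} :: ('v \<Rightarrow> 'a) set"
  define \<B> where "\<B> = {X. \<exists>Q \<R>. definable L U I (carrier M) Q \<and> {x. Q x} \<in> \<D> \<and> finite \<R> \<and>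
    (\<forall>R\<in>\<R>. avoided \<D> I R) \<and> ?S Q \<R> \<subseteq> X}"
  have memI: "X \<in> \<B>" if "definable L U I (carrier M) Q" "{x. Q x} \<in> \<D>" "finite \<R>"
    "\<forall>R\<in>\<R>. avoided \<D> I R" "?S Q \<R> \<subseteq> X" for X Q \<R>
    using that unfolding \<B>_def by blast
  have triv: "definable L U I (carrier M) (\<lambda>x. True)" "{x. True} \<in> \<D>"
    using definable_True ultrafilter_UNIV[OF D(1)] by auto
  have "{} \<notin> \<B>"
  proof
    assume "{} \<in> \<B>"
    then obtain Q \<R> where Q: "definable L U I (carrier M) Q" "{x. Q x} \<in> \<D>" "finite \<R>"
      "\<forall>R\<in>\<R>. avoided \<D> I R" and empty: "?S Q \<R> \<subseteq> {}" unfolding \<B>_def by blast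
    have av: "\<And>R. R \<in> \<R> \<Longrightarrow> avoided \<D> I R" using Q(4) by blast
    obtain m where "m \<in> submodel_points" "Q m" "\<And>R. R \<in> \<R> \<Longrightarrow> \<not> R (case_sum m v)"
      by (rule avoid_in_submodel[OF D Q(3) _ Q(1,2) v], erule av) (rule that)
    then show False using empty by blast
  qed
  moreover have "X \<inter> Y \<in> \<B>" if XY: "X \<in> \<B>" "Y \<in> \<B>" for X Y
  proof -
    obtain Q \<R> where Q: "definable L U I (carrier M) Q" "{x. Q x} \<in> \<D>" "finite \<R>"
      "\<forall>R\<in>\<R>. avoided \<D> I R" "?S Q \<R> \<subseteq> X" using XY(1) unfolding \<B>_def by blast
    obtain Q' \<R>' where Q': "definable L U I (carrier M) Q'" "{x. Q' x} \<in> \<D>" "finite \<R>'"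
      "\<forall>R\<in>\<R>'. avoided \<D> I R" "?S Q' \<R>' \<subseteq> Y" using XY(2) unfolding \<B>_def by blast
    show ?thesis
    proof (rule memI)
      show "definable L U I (carrier M) (\<lambda>x. Q x \<and> Q' x)" by (rule definable_conj[OF Q(1) Q'(1)])
      show "{x. Q x \<and> Q' x} \<in> \<D>"
        using ultrafilter_Int[OF D(1) Q(2) Q'(2)] by (simp add: Collect_conj_eq)
      show "finite (\<R> \<union> \<R>')" using Q(3) Q'(3) by simp
      show "\<forall>R\<in>\<R> \<union> \<R>'. avoided \<D> I R" using Q(4) Q'(4) by blast
      have "?S (\<lambda>x. Q x \<and> Q' x) (\<R> \<union> \<R>') \<subseteq> ?S Q \<R> \<inter> ?S Q' \<R>'" by blast
      also have "\<dots> \<subseteq> X \<inter> Y" by (rule Int_mono[OF Q(5) Q'(5)])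
      finally show "?S (\<lambda>x. Q x \<and> Q' x) (\<R> \<union> \<R>') \<subseteq> X \<inter> Y" .
    qed
  qed
  moreover have "UNIV \<in> \<B>" by (rule memI[OF triv, of "{}"]) auto
  ultimately obtain \<E> where \<E>: "ultrafilter \<E>" "\<B> \<subseteq> \<E>"
    using ultrafilter_exists by blast
  moreover have "submodel_points \<in> \<B>" by (rule memI[OF triv, of "{}"]) auto
  moreover have "{x. Q x} \<in> \<B>" if "definable L U I (carrier M) Q" "{x. Q x} \<in> \<D>" for Q
    by (rule memI[OF that, of "{}"]) auto
  moreover have "{x. \<not> R (case_sum x v)} \<in> \<B>" if "avoided \<D> I R" for R
    by (rule memI[OF triv, of "{R}"]) (use that in auto)
  ultimately show thesis using that by blast
qed

lemma coheir_realized: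
  assumes D: "ultrafilter \<D>" "submodel_points \<in> \<D>"
    and a: "realizes U a (restrict_type (coheir I \<D>) A)" and A: "A \<subseteq> carrier U"
    and R: "definable L U I A R" "{x. R x} \<in> \<D>"
  shows "R a"
proof -
  obtain \<phi> xs c where \<chi>: "(\<phi>, xs, c) \<in> pformulas L I A" "distinct xs"
    and Rp: "\<And>a. range a \<subseteq> carrier U \<Longrightarrow> R a \<longleftrightarrow> psat U a (\<phi>, xs, c)"
    by (rule definable_imp_pformula[OF R(1)]) (rule that)
  have "{x. R x} \<inter> submodel_points \<subseteq> {x. psat U x (\<phi>, xs, c)}"
    using Rp submodel_points_carrier by blast
  then have "{x. psat U x (\<phi>, xs, c)} \<in> \<D>"
    using ultrafilter_mono[OF D(1)] ultrafilter_Int[OF D(1) R(2) D(2)] by blast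
  moreover have "c \<in> lists A" using \<chi>(1) by (simp add: pformulas_def)
  moreover have "(\<phi>, xs, c) \<in> pformulas L I (carrier U)" using \<chi>(1) A by (auto simp: pformulas_def)
  ultimately have "(\<phi>, xs, c) \<in> restrict_type (coheir I \<D>) A"
    unfolding restrict_type_def coheir_def by blast
  then have "psat U a (\<phi>, xs, c)" "range a \<subseteq> carrier U" using a unfolding realizes_def by blast+
  then show ?thesis using Rp by blast
qed

section \<open>Kim-strictness of the constructed coheir\<close>

theorem Kim_strict_extension:
  fixes p :: "('a, 'f, 'r, 'v) pfm set"
  assumes p: "type_over L U I (carrier M) p"
  shows "\<exists>q. p \<subseteq> q \<and> Kim_strict L \<kappa> U I (carrier M) q"
proof -
  obtain \<D> :: "('v \<Rightarrow> 'a) set set" where \<D>: "ultrafilter \<D>" "submodel_points \<in> \<D>"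
    "\<And>\<chi>. \<chi> \<in> p \<Longrightarrow> {m. psat U m \<chi>} \<in> \<D>"
    by (rule type_ultrafilter[OF p]) (rule that)
  obtain m0 where m0: "m0 \<in> carrier U" using submodel_nonempty submodel_subset by blast
  \<comment> \<open>Variables are elements of the model, so this identity on the carrier provides
    all instances at once: every tuple \<open>b\<close> of \<open>U\<close> is its own value. The
    value \<open>m0\<close> elsewhere only keeps the range in the carrier.\<close>
  define v0 where "v0 x = (if x \<in> carrier U then x else m0)" for x
  have v0: "range v0 \<subseteq> carrier U" using m0 by (auto simp: v0_def)
  obtain \<E> where \<E>: "ultrafilter \<E>" "submodel_points \<in> \<E>"
    and \<E>_def: "\<And>Q. definable L U I (carrier M) Q \<Longrightarrow> {x. Q x} \<in> \<D> \<Longrightarrow> {x. Q x} \<in> \<E>"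
    and \<E>_avoid: "\<And>R. avoided \<D> I R \<Longrightarrow> {x. \<not> R (case_sum x v0)} \<in> \<E>"
    by (rule avoiding_ultrafilter[OF \<D>(1,2) v0]) (rule that)
  let ?q = "coheir I \<E>"
  have "p \<subseteq> ?q"
  proof
    fix \<chi> assume \<chi>: "\<chi> \<in> p"
    then have pf: "\<chi> \<in> pformulas L I (carrier M)" using p by (auto simp: type_over_def)
    then have "{m. psat U m \<chi>} \<in> \<E>" using \<E>_def[OF definable_pformula[OF pf]] \<D>(3)[OF \<chi>] by blast
    moreover have "pformulas L I (carrier M) \<subseteq> pformulas L I (carrier U)"
      using lists_mono[OF submodel_subset] by (auto simp: pformulas_def)
    ultimately show "\<chi> \<in> ?q" using pf unfolding coheir_def by blast
  qed
  moreover have "Kim_independent L U (carrier M) B (a ` I)"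
    if B: "B \<subseteq> carrier U" and a: "realizes U a (restrict_type ?q (carrier M \<union> B))" for B a
    unfolding Kim_independent_def
  proof (intro ballI notI)
    fix \<chi> assume "\<chi> \<in> tp_set L U B (carrier M \<union> a ` I)" and forks: "Kim_forks L U (carrier M) \<chi>"
    moreover obtain \<phi> b c where \<chi>: "\<chi> = (\<phi>, b, c)" by (cases \<chi>)
    ultimately have \<phi>: "\<phi> \<in> formulas L" "fv \<phi> \<subseteq> {..<length b + length c}"
      and b: "b \<in> lists B" and c: "c \<in> lists (carrier M \<union> a ` I)" and holds: "sat U ((!) (b @ c)) \<phi>"
      by (auto simp: tp_set_def tp_def pformulas_def)
    have MB: "carrier M \<union> B \<subseteq> carrier U" using submodel_subset B by blast
    \<comment> \<open>Label the parameters \<open>c\<close> by their origin in \<open>a\<close> or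
      \<open>M\<close>. Replacing \<open>a\<close> by variables then turns the forking formula into
      an \<open>M\<close>-definable relation \<open>R\<close>.\<close>
    have "carrier M \<union> a ` I = case_sum a id ` (I <+> carrier M)"
      by (auto simp: Plus_def image_Un image_image)
    then have "c \<in> map (case_sum a id) ` lists (I <+> carrier M)" using c by (simp only: lists_image)
    then obtain w where w: "w \<in> lists (I <+> carrier M)" "c = map (case_sum a id) w" by blast
    define J where "J = {j. Inl j \<in> set w}"
    have J: "finite J" "J \<subseteq> I"
      using finite_vimageI[OF finite_set inj_Inl, of w] w(1) by (auto simp: J_def vimage_def)
    have wJ: "w \<in> lists (J <+> carrier M)" using w(1) by (auto simp: J_def)
    let ?u = "map (Inl \<circ> Inr) b @ map (map_sum Inl id) w"
    define R where "R z \<longleftrightarrow> sat U ((!) (map (case_sum z id) ?u)) \<phi>" for z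
    have RI: "R (case_sum x v) \<longleftrightarrow> sat U ((!) (map v b @ map (case_sum x id) w)) \<phi>" for x v
    proof -
      have "case_sum (case_sum x v) id (map_sum Inl id y) = case_sum x id y" for y by (cases y) auto
      then have "map (case_sum (case_sum x v) id) ?u = map v b @ map (case_sum x id) w" by simp
      then show ?thesis unfolding R_def by (simp only:)
    qed
    have "map_sum Inl id y \<in> (J <+> UNIV) <+> carrier M" if "y \<in> J <+> carrier M" for y
      using that by auto
    then have "?u \<in> lists ((J <+> UNIV) <+> carrier M)" using wJ by (auto simp: in_lists_conv_set)
    moreover have "fv \<phi> \<subseteq> {..<length ?u}" using \<phi>(2) w(2) by simp
    ultimately have R: "definable L U (J <+> UNIV) (carrier M) R"
      unfolding definable_def R_def using \<phi>(1) by blast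
    have ran: "range a \<subseteq> carrier U" using a by (simp add: realizes_def)
    \<comment> \<open>Both ultrafilters give the same type over \<open>M\<close>, and
      \<open>a\<close> realizes the coheir of the second over a set containing
      \<open>M\<close>.\<close>
    have "matches \<D> J a"
      unfolding matches_def
    proof (intro conjI allI impI ran)
      fix Q assume Q: "definable L U J (carrier M) Q" "{x. Q x} \<in> \<D>"
      have "definable L U I (carrier M) Q" by (rule definable_mono[OF Q(1) J(2) subset_refl])
      from \<E>_def[OF this Q(2)] have "{x. Q x} \<in> \<E>" .
      moreover have "definable L U I (carrier M \<union> B) Q"
        by (rule definable_mono[OF Q(1) J(2)]) blast
      ultimately show "Q a" using coheir_realized[OF \<E> a MB] by blast
    qed
    moreover have "{v. range v \<subseteq> carrier U \<and> R (case_sum a v)} = solutions \<chi>"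
      unfolding RI solutions_def \<chi> psat.simps w(2)[symmetric] ..
    then have "small {v. range v \<subseteq> carrier U \<and> R (case_sum a v)}"
      using Kim_forks_small[OF forks] by simp
    ultimately have "avoided \<D> I R" unfolding avoided_def using J R by blast
    \<comment> \<open>The negated instance of \<open>R\<close> at \<open>b\<close> belongs to the
      coheir and has parameters in \<open>M\<close> and \<open>B\<close>, so it is true of
      \<open>a\<close>; but the formula \<chi> lies in the type of \<open>B\<close>, so
      \<open>R\<close> holds there.\<close>
    then have "{x. \<not> R (case_sum x v0)} \<in> \<E>" by (rule \<E>_avoid)
    moreover have "definable L U I (carrier M \<union> B) (\<lambda>x. \<not> R (case_sum x v0))"
    proof (rule definable_neg)
      have bv: "map v0 b = b" using b B by (intro map_idI) (auto simp: v0_def in_lists_conv_set)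
      have eq: "R (case_sum x v0) \<longleftrightarrow> sat U ((!) (map (case_sum x id) (map Inr b @ w))) \<phi>" for x
        unfolding RI bv by (simp add: comp_def)
      have "set w \<subseteq> I <+> (carrier M \<union> B)" using w(1) by (auto simp: in_lists_conv_set)
      then have "map Inr b @ w \<in> lists (I <+> (carrier M \<union> B))"
        using b by (auto simp: in_lists_conv_set)
      moreover have "fv \<phi> \<subseteq> {..<length (map Inr b @ w)}" using \<phi>(2) w(2) by simp
      ultimately show "definable L U I (carrier M \<union> B) (\<lambda>x. R (case_sum x v0))"
        unfolding definable_def eq using \<phi>(1) by blast
    qed
    ultimately have "\<not> R (case_sum a v0)"
      by (intro coheir_realized[OF \<E> a MB, of "\<lambda>x. \<not> R (case_sum x v0)"])
    moreover have "map v0 b = b" using b B by (intro map_idI) (auto simp: v0_def in_lists_conv_set)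
    ultimately show False using holds unfolding RI w(2) by simp
  qed
  ultimately show ?thesis
    unfolding Kim_strict_def using coheir_invariant[OF \<E>] by blast
qed

end

theorem theorem2p26:
  fixes L :: "('f, 'r) lang" and T :: "('f, 'r) fm set"
    and \<kappa> :: "'k rel" and U :: "('a, 'f, 'r) struct" and M :: "('a, 'f, 'r) struct"
    and I :: "'v set" and p :: "('a, 'f, 'r, 'v) pfm set"
  assumes "complete_theory L T"
    and "monster_model L T \<kappa> U"
    and "is_model L T M" and "elementary_submodel L M U" and "|carrier M| <o \<kappa>"
    and "|I| <o \<kappa>"
    and "type_over L U I (carrier M) p"
  shows "\<exists>q. global_type L U I q \<and> p \<subseteq> q \<and>
    invariant_type L U I (carrier M) q \<and> Kim_strict L \<kappa> U I (carrier M) q"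
proof -
  interpret monster_pair L U M \<kappa>
    using assms(2,4,5) by unfold_locales (auto simp: monster_model_def)
  obtain q where q: "p \<subseteq> q" "Kim_strict L \<kappa> U I (carrier M) q"
    using Kim_strict_extension[OF assms(7)] by blast
  then have "invariant_type L U I (carrier M) q" by (simp add: Kim_strict_def)
  with q show ?thesis unfolding invariant_type_def by blast
qed

end
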